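(* Let $\mathcal{D}$ be a triangulated category and let $t_1=(\mathcal{U}_1,\mathcal{V}_1)$ and $t_2=(\mathcal{U}_2,\mathcal{V}_2)$ be two torsion pairs in $\mathcal{D}$ such that $\mathcal{U}_1\subseteq\mathcal{U}_2$ and $\mathcal{U}_1[1]\subseteq\mathcal{U}_2$. Let $\mathcal{H}_{[t_1,t_2]}=\mathcal{U}_2\cap\mathcal{V}_1$. Denote by $\mathsf{tors}[t_1,t_2]$ the set of torsion pairs $t$ in $\mathcal{D}$ with $t_1\preccurlyeq t\preccurlyeq t_2$, by $\mathsf{t\text{-}str}[t_1,t_2]$ the set of $t$-structures $(\mathcal{D}^{\leqslant 0},\mathcal{D}^{\geqslant 0})$ on $\mathcal{D}$ such that $\mathcal{U}_1\subseteq\mathcal{D}^{\leqslant 0}\subseteq\mathcal{U}_2$, and by $\widetilde{\mathsf{tors}}\,\mathcal{H}_{[t_1,t_2]}$ (resp. $\widetilde{\mathsf{s\text{-}tors}}\,\mathcal{H}_{[t_1,t_2]}$) the set of torsion pairs (resp. $s$-torsion pairs) $(\mathcal{T},\mathcal{F})$ in $\mathcal{H}_{[t_1,t_2]}$ such that $\mathcal{T}[1]\subseteq\mathcal{U}_2$ and $\mathcal{F}[-1]\subseteq\mathcal{V}_1$. Then there are the following order preserving, mutually inverse bijections. (1) $\Phi:\mathsf{tors}[t_1,t_2]\rightleftarrows\widetilde{\mathsf{tors}}\,\mathcal{H}_{[t_1,t_2]}:\Psi$, where $\Phi(\mathcal{U},\mathcal{V})=(\mathcal{U}\cap\mathcal{V}_1,\mathcal{V}\cap\mathcal{U}_2)$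 and $\Psi(\mathcal{T},\mathcal{F})=(\mathcal{U}_1*\mathcal{T},\mathcal{F}*\mathcal{V}_2)$. (2) $\phi:\mathsf{t\text{-}str}[t_1,t_2]\rightleftarrows\widetilde{\mathsf{s\text{-}tors}}\,\mathcal{H}_{[t_1,t_2]}:\psi$, where $\phi(\mathcal{D}^{\leqslant 0},\mathcal{D}^{\geqslant 0})=(\mathcal{D}^{\leqslant 0}\cap\mathcal{V}_1,\mathcal{D}^{\geqslant 1}\cap\mathcal{U}_2)$ and $\psi(\mathcal{T},\mathcal{F})=(\mathcal{U}_1*\mathcal{T},\mathcal{F}[1]*\mathcal{V}_2[1])$.
   Context: All categories are skeletally small; all subcategories are full and closed under isomorphisms. $[1]$ is the shift functor of $\mathcal{D}$. For subcategories $\mathcal{X},\mathcal{Y}$ of $\mathcal{D}$, $\mathcal{X}*\mathcal{Y}$ is the subcategory of objects $A$ admitting a distinguished triangle $X\to A\to Y\to X[1]$ with $X\in\mathcal{X}$, $Y\in\mathcal{Y}$. Let $\mathcal{K}$ be $\mathcal{D}$ or an extension-closed subcategory of $\mathcal{D}$ (such as $\mathcal{U}_2\cap\mathcal{V}_1$), regarded as an extriangulated category with negative first extension $\mathbb{E}^{-1}(-,-)=\mathcal{D}(-,-[-1])$. A torsion pair in $\mathcal{K}$ is a pair $(\mathcal{T},\mathcal{F})$ of additive subcategories of $\mathcal{K}$ closed under direct sums and direct summands with $\mathcal{D}(\mathcal{T},\mathcal{F})=0$ and such that every $X\in\mathcal{K}$ admits a distinguished triangle $T\to X\to F\to T[1]$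 with $T\in\mathcal{T}$, $F\in\mathcal{F}$. It is an $s$-torsion pair if moreover $\mathcal{D}(\mathcal{T},\mathcal{F}[-1])=0$. For torsion pairs in $\mathcal{K}$, $(\mathcal{T}_1,\mathcal{F}_1)\preccurlyeq(\mathcal{T}_2,\mathcal{F}_2)$ means $\mathcal{D}(\mathcal{T}_1,\mathcal{F}_2)=0$ and $\mathcal{D}(\mathcal{T}_1,\mathcal{F}_2[-1])=0$; for $\mathcal{K}=\mathcal{D}$ this is equivalent to $\mathcal{T}_1\subseteq\mathcal{T}_2$ and $\mathcal{T}_1[1]\subseteq\mathcal{T}_2$. On $s$-torsion pairs $\preccurlyeq$ is inclusion of first components. A $t$-structure on $\mathcal{D}$ is a pair $(\mathcal{D}^{\leqslant 0},\mathcal{D}^{\geqslant 0})$ of subcategories such that, writing $\mathcal{D}^{\leqslant n}=\mathcal{D}^{\leqslant 0}[-n]$, $\mathcal{D}^{\geqslant n}=\mathcal{D}^{\geqslant 0}[-n]$: $\mathcal{D}(\mathcal{D}^{\leqslant 0},\mathcal{D}^{\geqslant 1})=0$, $\mathcal{D}=\mathcal{D}^{\leqslant 0}*\mathcal{D}^{\geqslant 1}$, $\mathcal{D}^{\leqslant 0}\subseteq\mathcal{D}^{\leqslant 1}$, $\mathcal{D}^{\geqslant 1}\subseteq\mathcal{D}^{\geqslant 0}$. $t$-structures are ordered by inclusion of aisles $\mathcal{D}^{\leqslant 0}$; order preserving for sets of torsion pairs means preserving $\preccurlyeq$. *)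

theory Defs
  imports "HOL-Algebra.Group"
begin

section \<open>Additive categories\<close>

record ('o, 'm) category_data =
  Obj :: "'o set"
  Arr :: "'m set"
  Dom :: "'m \<Rightarrow> 'o"
  Cod :: "'m \<Rightarrow> 'o"
  Id :: "'o \<Rightarrow> 'm"
  Comp :: "'m \<Rightarrow> 'm \<Rightarrow> 'm" (infixl "\<cdot>\<index>" 70)

definition Hom :: "('o, 'm, 'z) category_data_scheme \<Rightarrow> 'o \<Rightarrow> 'o \<Rightarrow> 'm set" where
  "Hom D X Y = {f \<in> Arr D. Dom D f = X \<and> Cod D f = Y}"

definition iso_arrow :: "('o, 'm, 'z) category_data_scheme \<Rightarrow> 'o \<Rightarrow> 'o \<Rightarrow> 'm \<Rightarrow> bool" where
  "iso_arrow D X Y f \<longleftrightarrow> f \<in> Hom D X Y \<and>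
     (\<exists>g\<in>Hom D Y X. g \<cdot>\<^bsub>D\<^esub> f = Id D X \<and> f \<cdot>\<^bsub>D\<^esub> g = Id D Y)"

definition isomorphic :: "('o, 'm, 'z) category_data_scheme \<Rightarrow> 'o \<Rightarrow> 'o \<Rightarrow> bool" where
  "isomorphic D X Y \<longleftrightarrow> (\<exists>f. iso_arrow D X Y f)"

locale category =
  fixes D :: "('o, 'm, 'z) category_data_scheme" (structure)
  assumes arr_Obj: "f \<in> Arr D \<Longrightarrow> Dom D f \<in> Obj D \<and> Cod D f \<in> Obj D"
    and Id_Hom: "X \<in> Obj D \<Longrightarrow> Id D X \<in> Hom D X X"
    and Comp_Hom: "f \<in> Hom D X Y \<Longrightarrow> g \<in> Hom D Y Z \<Longrightarrow> g \<cdot> f \<in> Hom D X Z"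
    and Comp_Id: "f \<in> Hom D X Y \<Longrightarrow> f \<cdot> Id D X = f"
    and Id_Comp: "f \<in> Hom D X Y \<Longrightarrow> Id D Y \<cdot> f = f"
    and Comp_assoc: "f \<in> Hom D W X \<Longrightarrow> g \<in> Hom D X Y \<Longrightarrow> h \<in> Hom D Y Z \<Longrightarrow>
      h \<cdot> (g \<cdot> f) = (h \<cdot> g) \<cdot> f"

record ('o, 'm) preadditive_data = "('o, 'm) category_data" +
  Zero :: "'o \<Rightarrow> 'o \<Rightarrow> 'm"
  Add :: "'m \<Rightarrow> 'm \<Rightarrow> 'm" (infixl "\<boxplus>\<index>" 65)

text \<open>The additive group of morphisms, in the multiplicative signature of HOL-Algebra.\<close>

definition Hom_group :: "('o, 'm, 'z) preadditive_data_scheme \<Rightarrow> 'o \<Rightarrow> 'o \<Rightarrow> 'm monoid" where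
  "Hom_group D X Y = \<lparr>carrier = Hom D X Y, mult = Add D, one = Zero D X Y\<rparr>"

definition Neg :: "('o, 'm, 'z) preadditive_data_scheme \<Rightarrow> 'm \<Rightarrow> 'm" where
  "Neg D f = inv\<^bsub>Hom_group D (Dom D f) (Cod D f)\<^esub> f"

definition is_zero_object :: "('o, 'm, 'z) preadditive_data_scheme \<Rightarrow> 'o \<Rightarrow> bool" where
  "is_zero_object D Z \<longleftrightarrow> Z \<in> Obj D \<and>
     (\<forall>X\<in>Obj D. Hom D X Z = {Zero D X Z} \<and> Hom D Z X = {Zero D Z X})"

definition is_biproduct :: "('o, 'm, 'z) preadditive_data_scheme \<Rightarrow> 'o \<Rightarrow> 'o \<Rightarrow> 'o \<Rightarrow> bool" where
  "is_biproduct D A X Y \<longleftrightarrow>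
     (\<exists>i\<in>Hom D X A. \<exists>j\<in>Hom D Y A. \<exists>p\<in>Hom D A X. \<exists>q\<in>Hom D A Y.
        p \<cdot>\<^bsub>D\<^esub> i = Id D X \<and> q \<cdot>\<^bsub>D\<^esub> j = Id D Y \<and>
        q \<cdot>\<^bsub>D\<^esub> i = Zero D X Y \<and> p \<cdot>\<^bsub>D\<^esub> j = Zero D Y X \<and>
        (i \<cdot>\<^bsub>D\<^esub> p) \<boxplus>\<^bsub>D\<^esub> (j \<cdot>\<^bsub>D\<^esub> q) = Id D A)"

locale additive_category = category D
  for D :: "('o, 'm, 'z) preadditive_data_scheme" (structure) +
  assumes Hom_comm_group: "X \<in> Obj D \<Longrightarrow> Y \<in> Obj D \<Longrightarrow> comm_group (Hom_group D X Y)"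
    and Comp_Add: "f \<in> Hom D X Y \<Longrightarrow> f' \<in> Hom D X Y \<Longrightarrow> g \<in> Hom D Y Z \<Longrightarrow>
      g \<cdot> (f \<boxplus> f') = (g \<cdot> f) \<boxplus> (g \<cdot> f')"
    and Add_Comp: "f \<in> Hom D X Y \<Longrightarrow> g \<in> Hom D Y Z \<Longrightarrow> g' \<in> Hom D Y Z \<Longrightarrow>
      (g \<boxplus> g') \<cdot> f = (g \<cdot> f) \<boxplus> (g' \<cdot> f)"
    and zero_object_exists: "\<exists>Z. is_zero_object D Z"
    and biproduct_exists: "X \<in> Obj D \<Longrightarrow> Y \<in> Obj D \<Longrightarrow> \<exists>A\<in>Obj D. is_biproduct D A X Y"


section \<open>Triangulated categories\<close>

text \<open>A member \<open>(f, g, h)\<close> of \<open>Dist D\<close> is a distinguished triangle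
  \<open>X \<rightarrow> Y \<rightarrow> Z \<rightarrow> X[1]\<close>; its objects are read off from the morphisms.\<close>

record ('o, 'm) triangulated_data = "('o, 'm) preadditive_data" +
  Sh :: "'o \<Rightarrow> 'o"
  ShArr :: "'m \<Rightarrow> 'm"
  Dist :: "('m \<times> 'm \<times> 'm) set"

definition is_triangle ::
  "('o, 'm, 'z) triangulated_data_scheme \<Rightarrow> 'o \<Rightarrow> 'o \<Rightarrow> 'o \<Rightarrow> 'm \<Rightarrow> 'm \<Rightarrow> 'm \<Rightarrow> bool" where
  "is_triangle D X Y Z f g h \<longleftrightarrow>
     f \<in> Hom D X Y \<and> g \<in> Hom D Y Z \<and> h \<in> Hom D Z (Sh D X)"

definition dist_triangle ::
  "('o, 'm, 'z) triangulated_data_scheme \<Rightarrow> 'o \<Rightarrow> 'o \<Rightarrow> 'o \<Rightarrow> 'm \<Rightarrow> 'm \<Rightarrow> 'm \<Rightarrow> bool" where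
  "dist_triangle D X Y Z f g h \<longleftrightarrow> is_triangle D X Y Z f g h \<and> (f, g, h) \<in> Dist D"

text \<open>The shift is only assumed to be an additive autoequivalence (fully faithful and essentially
  surjective); a strict automorphism is the special case where \<open>Sh\<close> is bijective on objects.
  The axioms on triangles are those of Verdier, \<open>octahedral\<close> being stated for arbitrary
  prescribed cones of \<open>f\<close>, \<open>g\<close> and \<open>g \<cdot> f\<close>.\<close>

locale triangulated_category = additive_category D
  for D :: "('o, 'm, 'z) triangulated_data_scheme" (structure) +
  assumes Sh_Obj: "X \<in> Obj D \<Longrightarrow> Sh D X \<in> Obj D"
    and ShArr_Id: "X \<in> Obj D \<Longrightarrow> ShArr D (Id D X) = Id D (Sh D X)"
    and ShArr_Comp: "f \<in> Hom D X Y \<Longrightarrow> g \<in> Hom D Y Z \<Longrightarrow>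
      ShArr D (g \<cdot> f) = ShArr D g \<cdot> ShArr D f"
    and ShArr_Add: "f \<in> Hom D X Y \<Longrightarrow> f' \<in> Hom D X Y \<Longrightarrow>
      ShArr D (f \<boxplus> f') = ShArr D f \<boxplus> ShArr D f'"
    and Sh_fully_faithful: "X \<in> Obj D \<Longrightarrow> Y \<in> Obj D \<Longrightarrow>
      bij_betw (ShArr D) (Hom D X Y) (Hom D (Sh D X) (Sh D Y))"
    and Sh_ess_surj: "Y \<in> Obj D \<Longrightarrow> \<exists>X\<in>Obj D. isomorphic D (Sh D X) Y"
    and Dist_triangle: "(f, g, h) \<in> Dist D \<Longrightarrow> \<exists>X Y Z. is_triangle D X Y Z f g h"
    and Dist_iso: "dist_triangle D X Y Z f g h \<Longrightarrow> is_triangle D X' Y' Z' f' g' h' \<Longrightarrow>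
      iso_arrow D X X' u \<Longrightarrow> iso_arrow D Y Y' v \<Longrightarrow> iso_arrow D Z Z' w \<Longrightarrow>
      v \<cdot> f = f' \<cdot> u \<Longrightarrow> w \<cdot> g = g' \<cdot> v \<Longrightarrow> ShArr D u \<cdot> h = h' \<cdot> w \<Longrightarrow>
      dist_triangle D X' Y' Z' f' g' h'"
    and Dist_Id: "X \<in> Obj D \<Longrightarrow> is_zero_object D Z \<Longrightarrow>
      dist_triangle D X X Z (Id D X) (Zero D X Z) (Zero D Z (Sh D X))"
    and Dist_cone: "f \<in> Hom D X Y \<Longrightarrow> \<exists>Z g h. dist_triangle D X Y Z f g h"
    and Dist_rotate: "is_triangle D X Y Z f g h \<Longrightarrow>
      dist_triangle D X Y Z f g h \<longleftrightarrow> dist_triangle D Y Z (Sh D X) g h (Neg D (ShArr D f))"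
    and Dist_morphism: "dist_triangle D X Y Z f g h \<Longrightarrow> dist_triangle D X' Y' Z' f' g' h' \<Longrightarrow>
      u \<in> Hom D X X' \<Longrightarrow> v \<in> Hom D Y Y' \<Longrightarrow> v \<cdot> f = f' \<cdot> u \<Longrightarrow>
      \<exists>w\<in>Hom D Z Z'. w \<cdot> g = g' \<cdot> v \<and> ShArr D u \<cdot> h = h' \<cdot> w"
    and octahedral: "dist_triangle D X Y A f a a' \<Longrightarrow> dist_triangle D Y Z B g b b' \<Longrightarrow>
      dist_triangle D X Z C (g \<cdot> f) c c' \<Longrightarrow>
      \<exists>u v. dist_triangle D A C B u v (ShArr D a \<cdot> b') \<and>
        u \<cdot> a = c \<cdot> g \<and> c' \<cdot> u = a' \<and> v \<cdot> c = b \<and> b' \<cdot> v = ShArr D f \<cdot> c'"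


section \<open>Subcategories, torsion pairs and t-structures\<close>

text \<open>Full subcategories closed under isomorphisms are represented by their sets of objects.\<close>

definition iso_closed_subcat :: "('o, 'm, 'z) category_data_scheme \<Rightarrow> 'o set \<Rightarrow> bool" where
  "iso_closed_subcat D \<X> \<longleftrightarrow>
     \<X> \<subseteq> Obj D \<and> (\<forall>A\<in>\<X>. \<forall>B\<in>Obj D. isomorphic D A B \<longrightarrow> B \<in> \<X>)"

text \<open>The subcategory \<open>\<X>[1]\<close>.\<close>

definition shift_up :: "('o, 'm, 'z) triangulated_data_scheme \<Rightarrow> 'o set \<Rightarrow> 'o set" where
  "shift_up D \<X> = {A \<in> Obj D. \<exists>X\<in>\<X>. isomorphic D (Sh D X) A}"

text \<open>The subcategory \<open>\<X>[-1]\<close>, for isomorphism-closed \<open>\<X>\<close>: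
  an object \<open>A\<close> is isomorphic to some \<open>X[-1]\<close> with \<open>X \<in> \<X>\<close>
  iff \<open>A[1] \<in> \<X>\<close>. No quasi-inverse of the shift has to be chosen.\<close>

definition shift_down :: "('o, 'm, 'z) triangulated_data_scheme \<Rightarrow> 'o set \<Rightarrow> 'o set" where
  "shift_down D \<X> = {A \<in> Obj D. Sh D A \<in> \<X>}"

definition star :: "('o, 'm, 'z) triangulated_data_scheme \<Rightarrow> 'o set \<Rightarrow> 'o set \<Rightarrow> 'o set" where
  "star D \<X> \<Y> = {A \<in> Obj D. \<exists>X\<in>\<X>. \<exists>Y\<in>\<Y>. \<exists>f g h. dist_triangle D X A Y f g h}"

definition Hom_vanishes :: "('o, 'm, 'z) preadditive_data_scheme \<Rightarrow> 'o set \<Rightarrow> 'o set \<Rightarrow> bool" where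
  "Hom_vanishes D \<X> \<Y> \<longleftrightarrow> (\<forall>X\<in>\<X>. \<forall>Y\<in>\<Y>. \<forall>f\<in>Hom D X Y. f = Zero D X Y)"

text \<open>Direct sums are finite direct sums; direct summands are taken in the ambient
  subcategory \<open>\<K>\<close>.\<close>

definition additive_summand_closed ::
  "('o, 'm, 'z) preadditive_data_scheme \<Rightarrow> 'o set \<Rightarrow> 'o set \<Rightarrow> bool" where
  "additive_summand_closed D \<K> \<X> \<longleftrightarrow>
     \<X> \<subseteq> \<K> \<and> iso_closed_subcat D \<X> \<and>
     (\<exists>Z\<in>\<X>. is_zero_object D Z) \<and>
     (\<forall>X\<in>\<X>. \<forall>Y\<in>\<X>. \<forall>A\<in>Obj D. is_biproduct D A X Y \<longrightarrow> A \<in> \<X>) \<and>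
     (\<forall>X\<in>\<K>. \<forall>Y\<in>\<K>. \<forall>A\<in>\<X>. is_biproduct D A X Y \<longrightarrow> X \<in> \<X> \<and> Y \<in> \<X>)"

definition torsion_pair ::
  "('o, 'm, 'z) triangulated_data_scheme \<Rightarrow> 'o set \<Rightarrow> 'o set \<times> 'o set \<Rightarrow> bool" where
  "torsion_pair D \<K> = (\<lambda>(\<T>, \<F>).
     additive_summand_closed D \<K> \<T> \<and> additive_summand_closed D \<K> \<F> \<and>
     Hom_vanishes D \<T> \<F> \<and>
     (\<forall>X\<in>\<K>. \<exists>T\<in>\<T>. \<exists>F\<in>\<F>. \<exists>f g h. dist_triangle D T X F f g h))"

definition s_torsion_pair ::
  "('o, 'm, 'z) triangulated_data_scheme \<Rightarrow> 'o set \<Rightarrow> 'o set \<times> 'o set \<Rightarrow> bool" where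
  "s_torsion_pair D \<K> = (\<lambda>(\<T>, \<F>).
     torsion_pair D \<K> (\<T>, \<F>) \<and> Hom_vanishes D \<T> (shift_down D \<F>))"

text \<open>This relation need not be reflexive on torsion pairs that are not s-torsion pairs.\<close>

definition tors_prec ::
  "('o, 'm, 'z) triangulated_data_scheme \<Rightarrow> 'o set \<times> 'o set \<Rightarrow> 'o set \<times> 'o set \<Rightarrow> bool" where
  "tors_prec D = (\<lambda>(\<T>\<^sub>1, \<F>\<^sub>1) (\<T>\<^sub>2, \<F>\<^sub>2).
     Hom_vanishes D \<T>\<^sub>1 \<F>\<^sub>2 \<and> Hom_vanishes D \<T>\<^sub>1 (shift_down D \<F>\<^sub>2))"

text \<open>In a pair \<open>(\<L>, \<G>)\<close>, \<open>\<L>\<close> is the aisle in degrees at most 0 and \<open>\<G>\<close> the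
  coaisle in degrees at least 0, so degrees at most 1 and at least 1 are
  \<open>\<L>[-1]\<close> and \<open>\<G>[-1]\<close>.\<close>

definition t_structure ::
  "('o, 'm, 'z) triangulated_data_scheme \<Rightarrow> 'o set \<times> 'o set \<Rightarrow> bool" where
  "t_structure D = (\<lambda>(\<L>, \<G>).
     iso_closed_subcat D \<L> \<and> iso_closed_subcat D \<G> \<and>
     Hom_vanishes D \<L> (shift_down D \<G>) \<and>
     Obj D = star D \<L> (shift_down D \<G>) \<and>
     \<L> \<subseteq> shift_down D \<L> \<and> shift_down D \<G> \<subseteq> \<G>)"

definition aisle_le :: "'o set \<times> 'o set \<Rightarrow> 'o set \<times> 'o set \<Rightarrow> bool" where
  "aisle_le s t \<longleftrightarrow> fst s \<subseteq> fst t"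


section \<open>Intervals of torsion pairs\<close>

definition interval_heart :: "'o set \<times> 'o set \<Rightarrow> 'o set \<times> 'o set \<Rightarrow> 'o set" where
  "interval_heart t\<^sub>1 t\<^sub>2 = fst t\<^sub>2 \<inter> snd t\<^sub>1"

definition tors_interval ::
  "('o, 'm, 'z) triangulated_data_scheme \<Rightarrow> 'o set \<times> 'o set \<Rightarrow> 'o set \<times> 'o set \<Rightarrow>
    ('o set \<times> 'o set) set" where
  "tors_interval D t\<^sub>1 t\<^sub>2 =
     {t. torsion_pair D (Obj D) t \<and> tors_prec D t\<^sub>1 t \<and> tors_prec D t t\<^sub>2}"

definition t_str_interval ::
  "('o, 'm, 'z) triangulated_data_scheme \<Rightarrow> 'o set \<times> 'o set \<Rightarrow> 'o set \<times> 'o set \<Rightarrow>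
    ('o set \<times> 'o set) set" where
  "t_str_interval D t\<^sub>1 t\<^sub>2 = {t. t_structure D t \<and> fst t\<^sub>1 \<subseteq> fst t \<and> fst t \<subseteq> fst t\<^sub>2}"

definition tors_tilde ::
  "('o, 'm, 'z) triangulated_data_scheme \<Rightarrow> 'o set \<times> 'o set \<Rightarrow> 'o set \<times> 'o set \<Rightarrow>
    ('o set \<times> 'o set) set" where
  "tors_tilde D t\<^sub>1 t\<^sub>2 =
     {(\<T>, \<F>). torsion_pair D (interval_heart t\<^sub>1 t\<^sub>2) (\<T>, \<F>) \<and>
        shift_up D \<T> \<subseteq> fst t\<^sub>2 \<and> shift_down D \<F> \<subseteq> snd t\<^sub>1}"

definition s_tors_tilde ::
  "('o, 'm, 'z) triangulated_data_scheme \<Rightarrow> 'o set \<times> 'o set \<Rightarrow> 'o set \<times> 'o set \<Rightarrow>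
    ('o set \<times> 'o set) set" where
  "s_tors_tilde D t\<^sub>1 t\<^sub>2 =
     {(\<T>, \<F>). s_torsion_pair D (interval_heart t\<^sub>1 t\<^sub>2) (\<T>, \<F>) \<and>
        shift_up D \<T> \<subseteq> fst t\<^sub>2 \<and> shift_down D \<F> \<subseteq> snd t\<^sub>1}"

definition inverse_order_bijections ::
  "'a set \<Rightarrow> ('a \<Rightarrow> 'a \<Rightarrow> bool) \<Rightarrow> 'b set \<Rightarrow> ('b \<Rightarrow> 'b \<Rightarrow> bool) \<Rightarrow> ('a \<Rightarrow> 'b) \<Rightarrow> ('b \<Rightarrow> 'a) \<Rightarrow> bool"
  where
  "inverse_order_bijections A le\<^sub>A B le\<^sub>B \<Phi> \<Psi> \<longleftrightarrow>
     bij_betw \<Phi> A B \<and> bij_betw \<Psi> B A \<and>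
     (\<forall>a\<in>A. \<Psi> (\<Phi> a) = a) \<and> (\<forall>b\<in>B. \<Phi> (\<Psi> b) = b) \<and>
     monotone_on A le\<^sub>A le\<^sub>B \<Phi> \<and> monotone_on B le\<^sub>B le\<^sub>A \<Psi>"

end

theory Submission
  imports Defs
begin

text \<open>
  Every condition in the theorem is a statement about vanishing Hom groups. For the two torsion
  pairs \<open>(\<U>\<^sub>1, \<V>\<^sub>1)\<close> and \<open>(\<U>\<^sub>2, \<V>\<^sub>2)\<close> the hypotheses say
  \<open>Hom(\<U>\<^sub>1, \<V>\<^sub>2) = Hom(\<U>\<^sub>1[1], \<V>\<^sub>2) = 0\<close>. For a torsion pair \<open>(\<T>, \<F>)\<close> in the
  heart \<open>\<U>\<^sub>2 \<inter> \<V>\<^sub>1\<close> the conditions on \<open>\<T>[1]\<close> and \<open>\<F>[-1]\<close> say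
  \<open>Hom(\<T>[1], \<V>\<^sub>2) = Hom(\<U>\<^sub>1[1], \<F>) = 0\<close>.

  The heart of the argument is that, under these conditions, the two extension subcategories are
  orthogonals: \<open>\<U>\<^sub>1 * \<T>\<close> is the left orthogonal of \<open>\<F> \<union> \<V>\<^sub>2\<close>, and \<open>\<F> * \<V>\<^sub>2\<close> is the
  right orthogonal of \<open>\<U>\<^sub>1 \<union> \<T>\<close> (\<open>extended_torsion_eq_left_orth\<close>,
  \<open>extended_torsion_free_eq_right_orth\<close>). For the first, decompose an object \<open>A\<close> of the left
  orthogonal as \<open>U \<rightarrow> A \<rightarrow> V \<rightarrow> U[1]\<close> along the lower pair. There are no maps from \<open>A\<close> or from
  \<open>U[1]\<close> to \<open>\<F> \<union> \<V>\<^sub>2\<close>, hence none from \<open>V\<close>; so \<open>V\<close> lies in the heart and is torsion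
  there. An orthogonal is automatically closed under isomorphisms, finite sums and summands, which
  would be awkward to see for \<open>\<U>\<^sub>1 * \<T>\<close> directly because decompositions along a torsion pair
  are not unique. That every object decomposes follows by decomposing successively along the lower
  pair, the upper pair and \<open>(\<T>, \<F>)\<close>, and regrouping the resulting filtration with the
  octahedral axiom.

  Conversely, let \<open>(\<U>, \<V>)\<close> be a torsion pair in the interval. The terms of its decomposition of
  an object of the heart stay in the heart, again by comparing Hom groups along the triangle, so
  it restricts to the heart. The composites are identities because a torsion pair is determined by
  orthogonality, both in the ambient category and, for the pairs considered here, in the heart.

  For t-structures nothing new has to be proved: a t-structure with aisle \<open>\<L>\<close> and coaisle \<open>\<G>\<close>
  is the same as a torsion pair \<open>(\<L>, \<G>[-1])\<close> that is related to itself by \<open>tors_prec\<close>, and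
  an s-torsion pair in the heart is a torsion pair there that is related to itself. Both directions
  of the first correspondence preserve that relation, so it restricts to the second one.
\<close>


section \<open>Calculus of morphisms\<close>

definition no_maps :: "('o, 'm, 'z) preadditive_data_scheme \<Rightarrow> 'o \<Rightarrow> 'o \<Rightarrow> bool" where
  "no_maps D X Y \<longleftrightarrow> (\<forall>f\<in>Hom D X Y. f = Zero D X Y)"

context category
begin

lemma Hom_objects: "f \<in> Hom D X Y \<Longrightarrow> X \<in> Obj D \<and> Y \<in> Obj D"
  using arr_Obj by (auto simp: Hom_def)

lemma isomorphic_objects: "isomorphic D X Y \<Longrightarrow> X \<in> Obj D \<and> Y \<in> Obj D"
  using Hom_objects by (auto simp: isomorphic_def iso_arrow_def)

lemma iso_arrow_Id: "X \<in> Obj D \<Longrightarrow> iso_arrow D X X (Id D X)"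
  using Id_Hom Comp_Id by (auto simp: iso_arrow_def)

lemma isomorphic_refl: "X \<in> Obj D \<Longrightarrow> isomorphic D X X"
  using iso_arrow_Id by (auto simp: isomorphic_def)

lemma isomorphic_sym: "isomorphic D X Y \<Longrightarrow> isomorphic D Y X"
  by (auto simp: isomorphic_def iso_arrow_def)

lemma isomorphic_trans: "isomorphic D X Y \<Longrightarrow> isomorphic D Y Z \<Longrightarrow> isomorphic D X Z"
proof -
  assume "isomorphic D X Y" "isomorphic D Y Z"
  then obtain f f' g g' where f: "f \<in> Hom D X Y" "f' \<in> Hom D Y X" "f' \<cdot> f = Id D X" "f \<cdot> f' = Id D Y"
    and g: "g \<in> Hom D Y Z" "g' \<in> Hom D Z Y" "g' \<cdot> g = Id D Y" "g \<cdot> g' = Id D Z"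
    unfolding isomorphic_def iso_arrow_def by blast
  have "(f' \<cdot> g') \<cdot> (g \<cdot> f) = f' \<cdot> ((g' \<cdot> g) \<cdot> f)"
    using Comp_assoc[OF Comp_Hom[OF f(1) g(1)] g(2) f(2)] Comp_assoc[OF f(1) g(1,2)] by simp
  then have 1: "(f' \<cdot> g') \<cdot> (g \<cdot> f) = Id D X" using f g Id_Comp[OF f(1)] by simp
  have "(g \<cdot> f) \<cdot> (f' \<cdot> g') = g \<cdot> ((f \<cdot> f') \<cdot> g')"
    using Comp_assoc[OF Comp_Hom[OF g(2) f(2)] f(1) g(1)] Comp_assoc[OF g(2) f(2,1)] by simp
  then have 2: "(g \<cdot> f) \<cdot> (f' \<cdot> g') = Id D Z" using f g Id_Comp[OF g(2)] by simp
  show ?thesis unfolding isomorphic_def iso_arrow_def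
    using 1 2 Comp_Hom[OF f(1) g(1)] Comp_Hom[OF g(2) f(2)] by blast
qed

lemma iso_closed_subcatD:
  "iso_closed_subcat D \<X> \<Longrightarrow> A \<in> \<X> \<Longrightarrow> isomorphic D A B \<Longrightarrow> B \<in> \<X>"
  using isomorphic_objects by (auto simp: iso_closed_subcat_def)

end

context additive_category
begin

lemma Zero_Hom: "X \<in> Obj D \<Longrightarrow> Y \<in> Obj D \<Longrightarrow> Zero D X Y \<in> Hom D X Y"
  using comm_group.axioms(2)[OF Hom_comm_group, THEN group.is_monoid, THEN monoid.one_closed]
  by (simp add: Hom_group_def)

lemma Add_Hom: "f \<in> Hom D X Y \<Longrightarrow> g \<in> Hom D X Y \<Longrightarrow> f \<boxplus> g \<in> Hom D X Y"
proof -
  assume fg: "f \<in> Hom D X Y" "g \<in> Hom D X Y"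
  interpret comm_group "Hom_group D X Y"
    using Hom_comm_group Hom_objects[OF fg(1)] by blast
  show ?thesis using m_closed fg by (simp add: Hom_group_def)
qed

lemma Neg_is_inverse: "f \<in> Hom D X Y \<Longrightarrow> Neg D f = inv\<^bsub>Hom_group D X Y\<^esub> f"
  by (simp add: Neg_def Hom_def)

lemma Neg_Hom: "f \<in> Hom D X Y \<Longrightarrow> Neg D f \<in> Hom D X Y"
proof -
  assume f: "f \<in> Hom D X Y"
  interpret comm_group "Hom_group D X Y"
    using Hom_comm_group Hom_objects[OF f] by blast
  show ?thesis using inv_closed f unfolding Neg_is_inverse[OF f] by (simp add: Hom_group_def)
qed

lemma Add_Neg: "f \<in> Hom D X Y \<Longrightarrow> f \<boxplus> Neg D f = Zero D X Y"
proof -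
  assume f: "f \<in> Hom D X Y"
  interpret comm_group "Hom_group D X Y"
    using Hom_comm_group Hom_objects[OF f] by blast
  show ?thesis using r_inv f unfolding Neg_is_inverse[OF f] by (simp add: Hom_group_def)
qed

lemma Add_Zero: "f \<in> Hom D X Y \<Longrightarrow> f \<boxplus> Zero D X Y = f"
proof -
  assume f: "f \<in> Hom D X Y"
  interpret comm_group "Hom_group D X Y"
    using Hom_comm_group Hom_objects[OF f] by blast
  show ?thesis using r_one f by (simp add: Hom_group_def)
qed

lemma Add_commute: "f \<in> Hom D X Y \<Longrightarrow> g \<in> Hom D X Y \<Longrightarrow> f \<boxplus> g = g \<boxplus> f"
proof -
  assume fg: "f \<in> Hom D X Y" "g \<in> Hom D X Y"
  interpret comm_group "Hom_group D X Y"
    using Hom_comm_group Hom_objects[OF fg(1)] by blast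
  show ?thesis using m_comm fg by (simp add: Hom_group_def)
qed

lemma Add_assoc: "f \<in> Hom D X Y \<Longrightarrow> g \<in> Hom D X Y \<Longrightarrow> h \<in> Hom D X Y \<Longrightarrow>
    (f \<boxplus> g) \<boxplus> h = f \<boxplus> (g \<boxplus> h)"
proof -
  assume fg: "f \<in> Hom D X Y" "g \<in> Hom D X Y" "h \<in> Hom D X Y"
  interpret comm_group "Hom_group D X Y"
    using Hom_comm_group Hom_objects[OF fg(1)] by blast
  show ?thesis using m_assoc fg by (simp add: Hom_group_def)
qed

lemma Zero_Add: "f \<in> Hom D X Y \<Longrightarrow> Zero D X Y \<boxplus> f = f"
  using Add_commute Add_Zero Zero_Hom Hom_objects by metis

lemma Neg_unique:
  assumes "f \<in> Hom D X Y" "g \<in> Hom D X Y" "f \<boxplus> g = Zero D X Y"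
  shows "g = Neg D f"
  using assms Add_assoc Add_commute Add_Neg Neg_Hom Add_Zero Zero_Add by metis

lemma Zero_unique:
  assumes "f \<in> Hom D X Y" "f \<boxplus> f = f"
  shows "f = Zero D X Y"
  using assms Add_assoc Add_Neg Neg_Hom Add_Zero by metis

lemma Neg_Neg: "f \<in> Hom D X Y \<Longrightarrow> Neg D (Neg D f) = f"
  using Neg_unique[OF Neg_Hom, of f X Y f] Add_commute[OF _ Neg_Hom, of f X Y f] Add_Neg[of f X Y]
  by simp

lemma Neg_Zero: "X \<in> Obj D \<Longrightarrow> Y \<in> Obj D \<Longrightarrow> Neg D (Zero D X Y) = Zero D X Y"
  using Neg_unique[of "Zero D X Y" X Y "Zero D X Y"] Add_Zero Zero_Hom by simp

lemma Comp_Zero: "g \<in> Hom D Y Z \<Longrightarrow> X \<in> Obj D \<Longrightarrow> g \<cdot> Zero D X Y = Zero D X Z"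
proof -
  assume g: "g \<in> Hom D Y Z" and X: "X \<in> Obj D"
  have z: "Zero D X Y \<in> Hom D X Y" using Zero_Hom Hom_objects[OF g] X by blast
  have "(g \<cdot> Zero D X Y) \<boxplus> (g \<cdot> Zero D X Y) = g \<cdot> Zero D X Y"
    using Comp_Add[OF z z g] Add_Zero[OF z] by simp
  then show ?thesis by (rule Zero_unique[OF Comp_Hom[OF z g]])
qed

lemma Zero_Comp: "f \<in> Hom D X Y \<Longrightarrow> Z \<in> Obj D \<Longrightarrow> Zero D Y Z \<cdot> f = Zero D X Z"
proof -
  assume f: "f \<in> Hom D X Y" and Z: "Z \<in> Obj D"
  have z: "Zero D Y Z \<in> Hom D Y Z" using Zero_Hom Hom_objects[OF f] Z by blast
  have "(Zero D Y Z \<cdot> f) \<boxplus> (Zero D Y Z \<cdot> f) = Zero D Y Z \<cdot> f"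
    using Add_Comp[OF f z z] Add_Zero[OF z] by simp
  then show ?thesis by (rule Zero_unique[OF Comp_Hom[OF f z]])
qed

lemma Comp_Neg: "f \<in> Hom D X Y \<Longrightarrow> g \<in> Hom D Y Z \<Longrightarrow> g \<cdot> Neg D f = Neg D (g \<cdot> f)"
proof -
  assume f: "f \<in> Hom D X Y" and g: "g \<in> Hom D Y Z"
  have "(g \<cdot> f) \<boxplus> (g \<cdot> Neg D f) = Zero D X Z"
    using Comp_Add[OF f Neg_Hom[OF f] g] Add_Neg[OF f] Comp_Zero[OF g] Hom_objects[OF f] by simp
  then show ?thesis by (rule Neg_unique[OF Comp_Hom[OF f g] Comp_Hom[OF Neg_Hom[OF f] g]])
qed

lemma Neg_Comp: "f \<in> Hom D X Y \<Longrightarrow> g \<in> Hom D Y Z \<Longrightarrow> Neg D g \<cdot> f = Neg D (g \<cdot> f)"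
proof -
  assume f: "f \<in> Hom D X Y" and g: "g \<in> Hom D Y Z"
  have "(g \<cdot> f) \<boxplus> (Neg D g \<cdot> f) = Zero D X Z"
    using Add_Comp[OF f g Neg_Hom[OF g]] Add_Neg[OF g] Zero_Comp[OF f] Hom_objects[OF g] by simp
  then show ?thesis by (rule Neg_unique[OF Comp_Hom[OF f g] Comp_Hom[OF f Neg_Hom[OF g]]])
qed

lemma zero_object_no_maps:
  "is_zero_object D Z \<Longrightarrow> X \<in> Obj D \<Longrightarrow> no_maps D X Z \<and> no_maps D Z X"
  by (auto simp: is_zero_object_def no_maps_def)

text \<open>An object is zero as soon as its identity is, since every map to or from it factors through the
  identity.\<close>

lemma zero_object_iff_Id: "is_zero_object D Z \<longleftrightarrow> Z \<in> Obj D \<and> Id D Z = Zero D Z Z"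
proof
  assume "is_zero_object D Z"
  then show "Z \<in> Obj D \<and> Id D Z = Zero D Z Z"
    using Id_Hom unfolding is_zero_object_def by blast
next
  assume Z: "Z \<in> Obj D \<and> Id D Z = Zero D Z Z"
  have "f = Zero D X Z" if "f \<in> Hom D X Z" for f X
    using Id_Comp Zero_Comp that Z by metis
  moreover have "f = Zero D Z X" if "f \<in> Hom D Z X" for f X
    using Comp_Id Comp_Zero that Z by metis
  ultimately show "is_zero_object D Z"
    unfolding is_zero_object_def using Z Zero_Hom by blast
qed

lemma no_maps_iso_left: "isomorphic D X X' \<Longrightarrow> no_maps D X Y \<Longrightarrow> no_maps D X' Y"
proof -
  assume "isomorphic D X X'" and n: "no_maps D X Y"
  then obtain u v where uv: "u \<in> Hom D X X'" "v \<in> Hom D X' X" "u \<cdot> v = Id D X'"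
    unfolding isomorphic_def iso_arrow_def by blast
  have "f = Zero D X' Y" if f: "f \<in> Hom D X' Y" for f
  proof -
    have "f = (f \<cdot> u) \<cdot> v" using Comp_assoc[OF uv(2,1) f] Comp_Id[OF f] uv(3) by simp
    also have "f \<cdot> u = Zero D X Y" using n Comp_Hom[OF uv(1) f] unfolding no_maps_def by blast
    finally show ?thesis using Zero_Comp[OF uv(2)] Hom_objects[OF f] by simp
  qed
  then show ?thesis unfolding no_maps_def by blast
qed

lemma no_maps_iso_right: "isomorphic D Y Y' \<Longrightarrow> no_maps D X Y \<Longrightarrow> no_maps D X Y'"
proof -
  assume "isomorphic D Y Y'" and n: "no_maps D X Y"
  then obtain u v where uv: "u \<in> Hom D Y Y'" "v \<in> Hom D Y' Y" "u \<cdot> v = Id D Y'"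
    unfolding isomorphic_def iso_arrow_def by blast
  have "f = Zero D X Y'" if f: "f \<in> Hom D X Y'" for f
  proof -
    have "f = u \<cdot> (v \<cdot> f)" using Comp_assoc[OF f uv(2,1)] Id_Comp[OF f] uv(3) by simp
    also have "v \<cdot> f = Zero D X Y" using n Comp_Hom[OF f uv(2)] unfolding no_maps_def by blast
    finally show ?thesis using Comp_Zero[OF uv(1)] Hom_objects[OF f] by simp
  qed
  then show ?thesis unfolding no_maps_def by blast
qed

lemma no_maps_biproduct_left:
  assumes "is_biproduct D A X Y"
  shows "no_maps D A B \<longleftrightarrow> no_maps D X B \<and> no_maps D Y B"
proof -
  obtain i j p q where h: "i \<in> Hom D X A" "j \<in> Hom D Y A" "p \<in> Hom D A X" "q \<in> Hom D A Y"
    and e: "p \<cdot> i = Id D X" "q \<cdot> j = Id D Y" "(i \<cdot> p) \<boxplus> (j \<cdot> q) = Id D A"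
    using assms unfolding is_biproduct_def by blast
  show ?thesis
  proof (intro iffI conjI)
    assume A: "no_maps D A B"
    show "no_maps D X B" unfolding no_maps_def
    proof
      fix f assume f: "f \<in> Hom D X B"
      have "f = (f \<cdot> p) \<cdot> i" using Comp_assoc[OF h(1,3) f] Comp_Id[OF f] e by simp
      then show "f = Zero D X B"
        using A Comp_Hom[OF h(3) f] Zero_Comp[OF h(1)] Hom_objects[OF f] unfolding no_maps_def by metis
    qed
    show "no_maps D Y B" unfolding no_maps_def
    proof
      fix f assume f: "f \<in> Hom D Y B"
      have "f = (f \<cdot> q) \<cdot> j" using Comp_assoc[OF h(2,4) f] Comp_Id[OF f] e by simp
      then show "f = Zero D Y B"
        using A Comp_Hom[OF h(4) f] Zero_Comp[OF h(2)] Hom_objects[OF f] unfolding no_maps_def by metis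
    qed
  next
    assume XY: "no_maps D X B \<and> no_maps D Y B"
    show "no_maps D A B" unfolding no_maps_def
    proof
      fix f assume f: "f \<in> Hom D A B"
      note o = Hom_objects[OF f]
      have "f = f \<cdot> ((i \<cdot> p) \<boxplus> (j \<cdot> q))" using e Comp_Id[OF f] by simp
      also have "\<dots> = (f \<cdot> (i \<cdot> p)) \<boxplus> (f \<cdot> (j \<cdot> q))"
        by (rule Comp_Add[OF Comp_Hom[OF h(3,1)] Comp_Hom[OF h(4,2)] f])
      also have "f \<cdot> (i \<cdot> p) = Zero D A B"
        using Comp_assoc[OF h(3,1) f] XY Comp_Hom[OF h(1) f] Zero_Comp[OF h(3)] o
        unfolding no_maps_def by metis
      also have "f \<cdot> (j \<cdot> q) = Zero D A B"
        using Comp_assoc[OF h(4,2) f] XY Comp_Hom[OF h(2) f] Zero_Comp[OF h(4)] o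
        unfolding no_maps_def by metis
      finally show "f = Zero D A B" using Add_Zero Zero_Hom o by metis
    qed
  qed
qed

lemma no_maps_biproduct_right:
  assumes "is_biproduct D A X Y"
  shows "no_maps D B A \<longleftrightarrow> no_maps D B X \<and> no_maps D B Y"
proof -
  obtain i j p q where h: "i \<in> Hom D X A" "j \<in> Hom D Y A" "p \<in> Hom D A X" "q \<in> Hom D A Y"
    and e: "p \<cdot> i = Id D X" "q \<cdot> j = Id D Y" "(i \<cdot> p) \<boxplus> (j \<cdot> q) = Id D A"
    using assms unfolding is_biproduct_def by blast
  show ?thesis
  proof (intro iffI conjI)
    assume A: "no_maps D B A"
    show "no_maps D B X" unfolding no_maps_def
    proof
      fix f assume f: "f \<in> Hom D B X"
      have "f = p \<cdot> (i \<cdot> f)" using Comp_assoc[OF f h(1,3)] Id_Comp[OF f] e by simp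
      then show "f = Zero D B X"
        using A Comp_Hom[OF f h(1)] Comp_Zero[OF h(3)] Hom_objects[OF f] unfolding no_maps_def by metis
    qed
    show "no_maps D B Y" unfolding no_maps_def
    proof
      fix f assume f: "f \<in> Hom D B Y"
      have "f = q \<cdot> (j \<cdot> f)" using Comp_assoc[OF f h(2,4)] Id_Comp[OF f] e by simp
      then show "f = Zero D B Y"
        using A Comp_Hom[OF f h(2)] Comp_Zero[OF h(4)] Hom_objects[OF f] unfolding no_maps_def by metis
    qed
  next
    assume XY: "no_maps D B X \<and> no_maps D B Y"
    show "no_maps D B A" unfolding no_maps_def
    proof
      fix f assume f: "f \<in> Hom D B A"
      note o = Hom_objects[OF f]
      have "f = ((i \<cdot> p) \<boxplus> (j \<cdot> q)) \<cdot> f" using e Id_Comp[OF f] by simp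
      also have "\<dots> = ((i \<cdot> p) \<cdot> f) \<boxplus> ((j \<cdot> q) \<cdot> f)"
        by (rule Add_Comp[OF f Comp_Hom[OF h(3,1)] Comp_Hom[OF h(4,2)]])
      also have "(i \<cdot> p) \<cdot> f = Zero D B A"
        using Comp_assoc[OF f h(3,1)] XY Comp_Hom[OF f h(3)] Comp_Zero[OF h(1)] o
        unfolding no_maps_def by metis
      also have "(j \<cdot> q) \<cdot> f = Zero D B A"
        using Comp_assoc[OF f h(4,2)] XY Comp_Hom[OF f h(4)] Comp_Zero[OF h(2)] o
        unfolding no_maps_def by metis
      finally show "f = Zero D B A" using Add_Zero Zero_Hom o by metis
    qed
  qed
qed

end


section \<open>Distinguished triangles on objects\<close>

text \<open>For torsion pairs only the objects of a triangle matter. Forgetting the morphisms makes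
  rotation an equivalence free of signs.\<close>

definition tri :: "('o, 'm, 'z) triangulated_data_scheme \<Rightarrow> 'o \<Rightarrow> 'o \<Rightarrow> 'o \<Rightarrow> bool" where
  "tri D X Y Z \<longleftrightarrow> (\<exists>f g h. dist_triangle D X Y Z f g h)"

context triangulated_category
begin

lemma dist_triangle_Hom:
  "dist_triangle D X Y Z f g h \<Longrightarrow> f \<in> Hom D X Y \<and> g \<in> Hom D Y Z \<and> h \<in> Hom D Z (Sh D X)"
  by (simp add: dist_triangle_def is_triangle_def)

lemma dist_triangle_objects:
  "dist_triangle D X Y Z f g h \<Longrightarrow> X \<in> Obj D \<and> Y \<in> Obj D \<and> Z \<in> Obj D"
  using dist_triangle_Hom Hom_objects by metis

lemma dist_triangle_rotate:
  "dist_triangle D X Y Z f g h \<Longrightarrow> dist_triangle D Y Z (Sh D X) g h (Neg D (ShArr D f))"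
  using Dist_rotate dist_triangle_def by metis

lemma ShArr_Hom: "f \<in> Hom D X Y \<Longrightarrow> ShArr D f \<in> Hom D (Sh D X) (Sh D Y)"
  using Sh_fully_faithful[of X Y] Hom_objects[of f X Y] bij_betwE by fast

lemma ShArr_full:
  assumes "X \<in> Obj D" "Y \<in> Obj D" "k \<in> Hom D (Sh D X) (Sh D Y)"
  obtains f where "f \<in> Hom D X Y" "ShArr D f = k"
proof -
  have "k \<in> ShArr D ` Hom D X Y"
    using bij_betw_imp_surj_on[OF Sh_fully_faithful[OF assms(1,2)]] assms(3) by simp
  then show thesis using that by blast
qed

lemma ShArr_faithful:
  "f \<in> Hom D X Y \<Longrightarrow> g \<in> Hom D X Y \<Longrightarrow> ShArr D f = ShArr D g \<Longrightarrow> f = g"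
  using inj_onD[OF bij_betw_imp_inj_on[OF Sh_fully_faithful]] Hom_objects[of f X Y] by metis

lemma ShArr_Zero: "X \<in> Obj D \<Longrightarrow> Y \<in> Obj D \<Longrightarrow> ShArr D (Zero D X Y) = Zero D (Sh D X) (Sh D Y)"
proof -
  assume "X \<in> Obj D" "Y \<in> Obj D"
  then have z: "Zero D X Y \<in> Hom D X Y" by (rule Zero_Hom)
  show ?thesis
    using Zero_unique[OF ShArr_Hom[OF z]] ShArr_Add[OF z z] Add_Zero[OF z] by simp
qed

lemma no_maps_Sh:
  assumes "X \<in> Obj D" "Y \<in> Obj D"
  shows "no_maps D (Sh D X) (Sh D Y) \<longleftrightarrow> no_maps D X Y"
proof
  assume n: "no_maps D (Sh D X) (Sh D Y)"
  have "f = Zero D X Y" if f: "f \<in> Hom D X Y" for f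
  proof (rule ShArr_faithful[OF f])
    show "Zero D X Y \<in> Hom D X Y" using Zero_Hom assms by blast
    show "ShArr D f = ShArr D (Zero D X Y)"
      using n ShArr_Hom[OF f] ShArr_Zero assms unfolding no_maps_def by simp
  qed
  then show "no_maps D X Y" unfolding no_maps_def by blast
next
  assume n: "no_maps D X Y"
  have "k = Zero D (Sh D X) (Sh D Y)" if k: "k \<in> Hom D (Sh D X) (Sh D Y)" for k
  proof -
    obtain f where "f \<in> Hom D X Y" "ShArr D f = k" using ShArr_full[OF assms k] .
    then show ?thesis using n ShArr_Zero[OF assms] unfolding no_maps_def by metis
  qed
  then show "no_maps D (Sh D X) (Sh D Y)" unfolding no_maps_def by blast
qed

lemma isomorphic_Sh:
  assumes "X \<in> Obj D" "Y \<in> Obj D"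
  shows "isomorphic D (Sh D X) (Sh D Y) \<longleftrightarrow> isomorphic D X Y"
proof
  assume "isomorphic D (Sh D X) (Sh D Y)"
  then obtain k l where k: "k \<in> Hom D (Sh D X) (Sh D Y)" "l \<in> Hom D (Sh D Y) (Sh D X)"
    "l \<cdot> k = Id D (Sh D X)" "k \<cdot> l = Id D (Sh D Y)"
    unfolding isomorphic_def iso_arrow_def by blast
  obtain f where f: "f \<in> Hom D X Y" "ShArr D f = k" using ShArr_full[OF assms k(1)] .
  obtain g where g: "g \<in> Hom D Y X" "ShArr D g = l" using ShArr_full[OF assms(2,1) k(2)] .
  have "g \<cdot> f = Id D X"
    by (rule ShArr_faithful[OF Comp_Hom[OF f(1) g(1)] Id_Hom])
      (simp_all add: assms ShArr_Id ShArr_Comp[OF f(1) g(1)] f g k)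
  moreover have "f \<cdot> g = Id D Y"
    by (rule ShArr_faithful[OF Comp_Hom[OF g(1) f(1)] Id_Hom])
      (simp_all add: assms ShArr_Id ShArr_Comp[OF g(1) f(1)] f g k)
  ultimately show "isomorphic D X Y"
    unfolding isomorphic_def iso_arrow_def using f g by blast
next
  assume "isomorphic D X Y"
  then obtain f g where f: "f \<in> Hom D X Y" "g \<in> Hom D Y X" "g \<cdot> f = Id D X" "f \<cdot> g = Id D Y"
    unfolding isomorphic_def iso_arrow_def by blast
  show "isomorphic D (Sh D X) (Sh D Y)"
    unfolding isomorphic_def iso_arrow_def
    using ShArr_Hom[OF f(1)] ShArr_Hom[OF f(2)] ShArr_Comp[OF f(1,2)] ShArr_Comp[OF f(2,1)] f(3,4)
      ShArr_Id assms by auto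
qed

lemma zero_object_Sh:
  assumes "Z \<in> Obj D"
  shows "is_zero_object D (Sh D Z) \<longleftrightarrow> is_zero_object D Z"
  using ShArr_Id[OF assms] ShArr_Zero[OF assms assms] Sh_Obj[OF assms] assms
    ShArr_faithful[OF Id_Hom[OF assms] Zero_Hom[OF assms assms]]
  unfolding zero_object_iff_Id by auto

lemma dist_triangle_Zero_Id:
  assumes "W \<in> Obj D" "is_zero_object D Z"
  shows "dist_triangle D Z W W (Zero D Z W) (Id D W) (Zero D W (Sh D Z))"
proof -
  have Z: "Z \<in> Obj D" using assms by (simp add: is_zero_object_def)
  have "is_triangle D Z W W (Zero D Z W) (Id D W) (Zero D W (Sh D Z))"
    using assms Z Zero_Hom Id_Hom Sh_Obj by (simp add: is_triangle_def)
  moreover have "dist_triangle D W W (Sh D Z) (Id D W) (Zero D W (Sh D Z)) (Zero D (Sh D Z) (Sh D W))"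
    using Dist_Id assms Z zero_object_Sh by blast
  ultimately show ?thesis
    using Dist_rotate ShArr_Zero[OF Z assms(1)] Neg_Zero[OF Sh_Obj[OF Z] Sh_Obj[OF assms(1)]] by simp
qed

text \<open>Exactness of the contravariant Hom functor at the middle term: compare the triangle with the
  trivial triangle \<open>0 \<rightarrow> W \<rightarrow> W \<rightarrow> 0[1]\<close>.\<close>

lemma factor_through_second:
  assumes t: "dist_triangle D X Y Z f g h" and k: "k \<in> Hom D Y W" "k \<cdot> f = Zero D X W"
  obtains l where "l \<in> Hom D Z W" "k = l \<cdot> g"
proof -
  obtain N where N: "is_zero_object D N" using zero_object_exists by blast
  then have No: "N \<in> Obj D" by (simp add: is_zero_object_def)
  note o = dist_triangle_objects[OF t] Hom_objects[OF k(1)]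
  have "k \<cdot> f = Zero D N W \<cdot> Zero D X N"
    using k(2) Comp_Zero[OF Zero_Hom[of N W], of X] No o by simp
  then obtain l where "l \<in> Hom D Z W" "l \<cdot> g = Id D W \<cdot> k"
    using Dist_morphism[OF t dist_triangle_Zero_Id[of W N], of "Zero D X N" k] N No o k(1)
      Zero_Hom[of X N] by blast
  then show thesis using that Id_Comp[OF k(1)] by metis
qed

text \<open>Exactness of the covariant Hom functor. The axiom on morphisms completes a square at the third
  vertex, whereas a map into the first vertex is wanted; so both triangles are rotated once and the
  map obtained between shifted objects is desuspended by full faithfulness.\<close>

lemma factor_through_first:
  assumes t: "dist_triangle D X Y Z f g h" and k: "k \<in> Hom D W Y" "g \<cdot> k = Zero D W Z"
  obtains l where "l \<in> Hom D W X" "k = f \<cdot> l"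
proof -
  obtain N where N: "is_zero_object D N" using zero_object_exists by blast
  then have No: "N \<in> Obj D" by (simp add: is_zero_object_def)
  note o = dist_triangle_objects[OF t] Hom_objects[OF k(1)]
  note H = dist_triangle_Hom[OF t]
  have W: "dist_triangle D W N (Sh D W) (Zero D W N) (Zero D N (Sh D W)) (Neg D (ShArr D (Id D W)))"
    using dist_triangle_rotate Dist_Id N o by blast
  have "Zero D N Z \<cdot> Zero D W N = g \<cdot> k"
    using k(2) Comp_Zero[OF Zero_Hom[of N Z], of W] No o by simp
  then obtain w where w: "w \<in> Hom D (Sh D W) (Sh D X)"
      "ShArr D k \<cdot> Neg D (ShArr D (Id D W)) = Neg D (ShArr D f) \<cdot> w"
    using Dist_morphism[OF W dist_triangle_rotate[OF t] k(1), of "Zero D N Z"] No o Zero_Hom[of N Z]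
    by auto
  obtain l where l: "l \<in> Hom D W X" "ShArr D l = w" using ShArr_full[OF _ _ w(1)] o by blast
  have f: "f \<in> Hom D X Y" and Wo: "W \<in> Obj D" using H o by blast+
  note fl = Comp_Hom[OF l(1) f]
  have "Neg D (ShArr D k) = ShArr D k \<cdot> Neg D (Id D (Sh D W))"
    unfolding Comp_Neg[OF Id_Hom[OF Sh_Obj[OF Wo]] ShArr_Hom[OF k(1)]]
      Comp_Id[OF ShArr_Hom[OF k(1)]] ..
  also have "\<dots> = Neg D (ShArr D f) \<cdot> w" using w(2) unfolding ShArr_Id[OF Wo] .
  also have "\<dots> = Neg D (ShArr D (f \<cdot> l))"
    unfolding Neg_Comp[OF w(1) ShArr_Hom[OF f]] ShArr_Comp[OF l(1) f] l(2) ..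
  finally have n: "Neg D (ShArr D k) = Neg D (ShArr D (f \<cdot> l))" .
  have "ShArr D k = ShArr D (f \<cdot> l)"
    using Neg_Neg[OF ShArr_Hom[OF k(1)]] Neg_Neg[OF ShArr_Hom[OF fl]] unfolding n by simp
  then have "k = f \<cdot> l" by (rule ShArr_faithful[OF k(1) fl])
  then show thesis using that l by blast
qed

lemma consecutive_zero:
  assumes t: "dist_triangle D X Y Z f g h"
  shows "g \<cdot> f = Zero D X Z"
proof -
  obtain N where N: "is_zero_object D N" using zero_object_exists by blast
  note o = dist_triangle_objects[OF t]
  note H = dist_triangle_Hom[OF t]
  have No: "N \<in> Obj D" using N by (simp add: is_zero_object_def)
  obtain w where "w \<in> Hom D N Z" "w \<cdot> Zero D X N = g \<cdot> f"
    using Dist_morphism[OF Dist_Id[OF _ N] t, of X "Id D X" f] o H Id_Hom[of X] by auto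
  then show ?thesis using Comp_Zero[of w N Z X] o by simp
qed

lemma tri_objects: "tri D X Y Z \<Longrightarrow> X \<in> Obj D \<and> Y \<in> Obj D \<and> Z \<in> Obj D"
  unfolding tri_def using dist_triangle_objects by blast

text \<open>Rotating back requires the map from \<open>Sh D X\<close> to be, up to sign, the shift of a map from \<open>X\<close>;
  fullness of the shift provides it.\<close>

lemma tri_rotate:
  assumes X: "X \<in> Obj D"
  shows "tri D X Y Z \<longleftrightarrow> tri D Y Z (Sh D X)"
proof
  show "tri D X Y Z \<Longrightarrow> tri D Y Z (Sh D X)"
    unfolding tri_def using dist_triangle_rotate by blast
next
  assume "tri D Y Z (Sh D X)"
  then obtain g h k where t: "dist_triangle D Y Z (Sh D X) g h k" unfolding tri_def by blast
  note H = dist_triangle_Hom[OF t]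
  obtain f where f: "f \<in> Hom D X Y" "ShArr D f = Neg D k"
    using ShArr_full[OF X _ Neg_Hom] H dist_triangle_objects[OF t] by blast
  then have "Neg D (ShArr D f) = k" using Neg_Neg[of k "Sh D X" "Sh D Y"] H by simp
  then have "dist_triangle D X Y Z f g h"
    using Dist_rotate[of X Y Z f g h] t f(1) H unfolding is_triangle_def by simp
  then show "tri D X Y Z" unfolding tri_def by blast
qed

lemma tri_Sh:
  assumes "X \<in> Obj D" "Y \<in> Obj D" "Z \<in> Obj D"
  shows "tri D (Sh D X) (Sh D Y) (Sh D Z) \<longleftrightarrow> tri D X Y Z"
  using assms tri_rotate by blast

lemma tri_iso:
  assumes "tri D X Y Z" "isomorphic D X X'" "isomorphic D Y Y'" "isomorphic D Z Z'"
  shows "tri D X' Y' Z'"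
proof -
  obtain f g h where t: "dist_triangle D X Y Z f g h" using assms unfolding tri_def by blast
  obtain u where u: "iso_arrow D X X' u" using assms unfolding isomorphic_def by blast
  obtain v where v: "iso_arrow D Y Y' v" using assms unfolding isomorphic_def by blast
  obtain w where w: "iso_arrow D Z Z' w" using assms unfolding isomorphic_def by blast
  obtain u' where u': "u' \<in> Hom D X' X" "u' \<cdot> u = Id D X" using u unfolding iso_arrow_def by blast
  obtain v' where v': "v' \<in> Hom D Y' Y" "v' \<cdot> v = Id D Y" using v unfolding iso_arrow_def by blast
  obtain w' where w': "w' \<in> Hom D Z' Z" "w' \<cdot> w = Id D Z" using w unfolding iso_arrow_def by blast
  note H = dist_triangle_Hom[OF t]
  have uh: "u \<in> Hom D X X'" "v \<in> Hom D Y Y'" "w \<in> Hom D Z Z'"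
    using u v w unfolding iso_arrow_def by auto
  have c: "v \<cdot> f \<in> Hom D X Y'" "w \<cdot> g \<in> Hom D Y Z'" "ShArr D u \<cdot> h \<in> Hom D Z (Sh D X')"
    using Comp_Hom[OF _ uh(2)] Comp_Hom[OF _ uh(3)] Comp_Hom[OF _ ShArr_Hom[OF uh(1)]] H by auto
  have "dist_triangle D X' Y' Z' ((v \<cdot> f) \<cdot> u') ((w \<cdot> g) \<cdot> v') ((ShArr D u \<cdot> h) \<cdot> w')"
  proof (rule Dist_iso[OF t _ u v w])
    show "is_triangle D X' Y' Z' ((v \<cdot> f) \<cdot> u') ((w \<cdot> g) \<cdot> v') ((ShArr D u \<cdot> h) \<cdot> w')"
      unfolding is_triangle_def using Comp_Hom[OF u'(1) c(1)] Comp_Hom[OF v'(1) c(2)]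
        Comp_Hom[OF w'(1) c(3)] by blast
    show "v \<cdot> f = ((v \<cdot> f) \<cdot> u') \<cdot> u"
      using Comp_assoc[OF uh(1) u'(1) c(1)] Comp_Id[OF c(1)] u'(2) by simp
    show "w \<cdot> g = ((w \<cdot> g) \<cdot> v') \<cdot> v"
      using Comp_assoc[OF uh(2) v'(1) c(2)] Comp_Id[OF c(2)] v'(2) by simp
    show "ShArr D u \<cdot> h = ((ShArr D u \<cdot> h) \<cdot> w') \<cdot> w"
      using Comp_assoc[OF uh(3) w'(1) c(3)] Comp_Id[OF c(3)] w'(2) by simp
  qed
  then show ?thesis unfolding tri_def by blast
qed

lemma desuspension:
  assumes "Y \<in> Obj D"
  obtains X where "X \<in> Obj D" "isomorphic D (Sh D X) Y"
  using Sh_ess_surj assms by blast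

text \<open>The octahedron of \<open>T \<rightarrow> H \<rightarrow> V\<close> regroups a filtration of \<open>V\<close> with factors \<open>T\<close>, \<open>F\<close>, \<open>W\<close>:
  the last two factors are joined instead of the first two.\<close>

lemma tri_filtration_quotient:
  assumes "tri D T H F" "tri D H V W"
  obtains Q where "tri D T V Q" "tri D F Q W"
proof -
  obtain f a a' where 1: "dist_triangle D T H F f a a'" using assms unfolding tri_def by blast
  obtain g b b' where 2: "dist_triangle D H V W g b b'" using assms unfolding tri_def by blast
  obtain Q c c' where 3: "dist_triangle D T V Q (g \<cdot> f) c c'"
    using Dist_cone[OF Comp_Hom[of f T H g V]] dist_triangle_Hom[OF 1] dist_triangle_Hom[OF 2] by blast
  show thesis using octahedral[OF 1 2 3] 3 that unfolding tri_def by blast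
qed

text \<open>The dual regrouping. The octahedron of \<open>X \<rightarrow> V \<rightarrow> Q\<close> yields the cone of the composite, which is
  the shift of the wanted object \<open>P\<close>.\<close>

lemma tri_filtration_sub:
  assumes "tri D U X V" "tri D T V Q"
  obtains P where "tri D P X Q" "tri D U P T"
proof -
  note o = tri_objects[OF assms(1)] tri_objects[OF assms(2)]
  have "tri D X V (Sh D U)" "tri D V Q (Sh D T)" using assms tri_rotate o by blast+
  then obtain f a a' g b b' where 1: "dist_triangle D X V (Sh D U) f a a'"
    and 2: "dist_triangle D V Q (Sh D T) g b b'" unfolding tri_def by blast
  obtain C c c' where 3: "dist_triangle D X Q C (g \<cdot> f) c c'"
    using Dist_cone[OF Comp_Hom[of f X V g Q]] dist_triangle_Hom[OF 1] dist_triangle_Hom[OF 2] by blast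
  then have C: "C \<in> Obj D" using dist_triangle_objects by blast
  obtain P where P: "P \<in> Obj D" "isomorphic D (Sh D P) C" using desuspension[OF C] by blast
  have "tri D (Sh D U) C (Sh D T)" using octahedral[OF 1 2 3] unfolding tri_def by blast
  then have "tri D (Sh D U) (Sh D P) (Sh D T)"
    using tri_iso[OF _ isomorphic_refl isomorphic_sym[OF P(2)] isomorphic_refl] o Sh_Obj by blast
  then have UPT: "tri D U P T" using tri_Sh P o by blast
  have "tri D X Q C" using 3 unfolding tri_def by blast
  then have "tri D X Q (Sh D P)"
    using tri_iso[OF _ isomorphic_refl isomorphic_refl isomorphic_sym[OF P(2)]] o by blast
  then have "tri D P X Q" using tri_rotate P by blast
  then show thesis using that UPT by blast
qed

lemma no_maps_from_middle:
  assumes "tri D X Y Z" "no_maps D X W" "no_maps D Z W"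
  shows "no_maps D Y W"
proof -
  obtain f g h where t: "dist_triangle D X Y Z f g h" using assms unfolding tri_def by blast
  note H = dist_triangle_Hom[OF t]
  show ?thesis unfolding no_maps_def
  proof
    fix k assume k: "k \<in> Hom D Y W"
    then have "k \<cdot> f = Zero D X W" using assms H Comp_Hom unfolding no_maps_def by metis
    then obtain l where "l \<in> Hom D Z W" "k = l \<cdot> g" using factor_through_second[OF t k] by blast
    then show "k = Zero D Y W" using assms Zero_Comp H Hom_objects[OF k] unfolding no_maps_def by metis
  qed
qed

lemma no_maps_to_middle:
  assumes "tri D X Y Z" "no_maps D W X" "no_maps D W Z"
  shows "no_maps D W Y"
proof -
  obtain f g h where t: "dist_triangle D X Y Z f g h" using assms unfolding tri_def by blast
  note H = dist_triangle_Hom[OF t]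
  show ?thesis unfolding no_maps_def
  proof
    fix k assume k: "k \<in> Hom D W Y"
    then have "g \<cdot> k = Zero D W Z" using assms H Comp_Hom unfolding no_maps_def by metis
    then obtain l where "l \<in> Hom D W X" "k = f \<cdot> l" using factor_through_first[OF t k] by blast
    then show "k = Zero D W Y" using assms Comp_Zero H Hom_objects[OF k] unfolding no_maps_def by metis
  qed
qed

lemma no_maps_from_cone:
  assumes "tri D X Y Z" "no_maps D Y W" "no_maps D (Sh D X) W"
  shows "no_maps D Z W"
  using no_maps_from_middle assms tri_rotate tri_objects by blast

text \<open>The shift of a map \<open>W \<rightarrow> X\<close> is a map from \<open>W[1]\<close> to the middle term of
  \<open>Z \<rightarrow> X[1] \<rightarrow> Y[1]\<close>, so the hypothesis about \<open>Z\<close> concerns \<open>W[1]\<close> instead of \<open>W\<close>.\<close>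

lemma no_maps_to_cocone:
  assumes t: "tri D X Y Z" and W: "W \<in> Obj D" "no_maps D W Y" "no_maps D (Sh D W) Z"
  shows "no_maps D W X"
proof -
  note o = tri_objects[OF t]
  have "tri D Z (Sh D X) (Sh D Y)" using t o tri_rotate by blast
  then have "no_maps D (Sh D W) (Sh D X)" using no_maps_to_middle no_maps_Sh W o by blast
  then show ?thesis using no_maps_Sh W o by blast
qed

text \<open>The idempotent \<open>e = id - s g\<close>, for a section \<open>s\<close> of \<open>g\<close>, factors through \<open>f\<close> as \<open>f p\<close>, and
  \<open>p\<close> is the projection onto \<open>X\<close>. The identities for \<open>p f\<close> and \<open>p s\<close> are checked after
  composition with \<open>f\<close>, which is a monomorphism because the connecting map vanishes.\<close>

lemma split_triangle:
  assumes t: "dist_triangle D X Y Z f g (Zero D Z (Sh D X))"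
  shows "is_biproduct D Y X Z"
proof -
  note H = dist_triangle_Hom[OF t]
  note o = dist_triangle_objects[OF t]
  note t1 = dist_triangle_rotate[OF t]
  have gf: "g \<cdot> f = Zero D X Z" by (rule consecutive_zero[OF t])
  have "Zero D Z (Sh D X) \<cdot> Id D Z = Zero D Z (Sh D X)" using Comp_Id H by blast
  then obtain s where s: "s \<in> Hom D Z Y" "Id D Z = g \<cdot> s"
    using factor_through_first[OF t1 Id_Hom] o by metis
  have e1: "(s \<cdot> g) \<in> Hom D Y Y" using Comp_Hom s H by blast
  define e where "e = Id D Y \<boxplus> Neg D (s \<cdot> g)"
  have e: "e \<in> Hom D Y Y" unfolding e_def using Add_Hom Id_Hom Neg_Hom e1 o by blast
  have "g \<cdot> e = (g \<cdot> Id D Y) \<boxplus> (g \<cdot> Neg D (s \<cdot> g))"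
    unfolding e_def using Comp_Add Id_Hom Neg_Hom e1 o H by blast
  also have "\<dots> = g \<boxplus> Neg D ((g \<cdot> s) \<cdot> g)"
    using Comp_Id Comp_Neg[OF e1] Comp_assoc[of g Y Z s Y g Z] H s by metis
  also have "\<dots> = Zero D Y Z" using s(2) Id_Comp Add_Neg H by metis
  finally obtain p where p: "p \<in> Hom D Y X" "e = f \<cdot> p"
    using factor_through_first[OF t e] by blast
  have es: "e \<cdot> s = Zero D Z Y"
  proof -
    have "e \<cdot> s = (Id D Y \<cdot> s) \<boxplus> (Neg D (s \<cdot> g) \<cdot> s)"
      unfolding e_def using Add_Comp[OF s(1) Id_Hom Neg_Hom[OF e1]] o by blast
    also have "\<dots> = s \<boxplus> Neg D (s \<cdot> (g \<cdot> s))"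
      using Id_Comp Neg_Comp[OF s(1) e1] Comp_assoc[OF s(1) _ s(1), of g] H s(1) by metis
    also have "\<dots> = Zero D Z Y" using s Comp_Id Add_Neg by metis
    finally show ?thesis .
  qed
  have ef: "e \<cdot> f = f"
  proof -
    have "e \<cdot> f = (Id D Y \<cdot> f) \<boxplus> (Neg D (s \<cdot> g) \<cdot> f)"
      unfolding e_def using Add_Comp[OF _ Id_Hom Neg_Hom[OF e1]] o H by blast
    also have "\<dots> = f \<boxplus> Neg D (s \<cdot> (g \<cdot> f))"
      using Id_Comp Neg_Comp[OF _ e1] Comp_assoc[OF _ _ s(1), of f X Y g] H by metis
    also have "\<dots> = f" using gf s Comp_Zero Neg_Zero Add_Zero o H by metis
    finally show ?thesis .
  qed
  have f_monic: "k = Zero D W X" if k: "k \<in> Hom D W X" "f \<cdot> k = Zero D W Y" for k W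
  proof -
    have W: "W \<in> Obj D" using k Hom_objects by blast
    have "dist_triangle D Z (Sh D X) (Sh D Y) (Zero D Z (Sh D X)) (Neg D (ShArr D f)) (Neg D (ShArr D g))"
      using dist_triangle_rotate[OF t1] .
    moreover have "Neg D (ShArr D f) \<cdot> ShArr D k = Zero D (Sh D W) (Sh D Y)"
      using Neg_Comp[OF ShArr_Hom[OF k(1)] ShArr_Hom] H ShArr_Comp[OF k(1)] k(2) ShArr_Zero Neg_Zero
        Sh_Obj o W by metis
    ultimately obtain l where "l \<in> Hom D (Sh D W) Z" "ShArr D k = Zero D Z (Sh D X) \<cdot> l"
      using factor_through_first ShArr_Hom[OF k(1)] by metis
    then have "ShArr D k = ShArr D (Zero D W X)" using Zero_Comp ShArr_Zero W o Sh_Obj by metis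
    then show ?thesis using ShArr_faithful k(1) Zero_Hom W o by blast
  qed
  have pf: "p \<cdot> f = Id D X"
  proof -
    define d where "d = (p \<cdot> f) \<boxplus> Neg D (Id D X)"
    have pfh: "p \<cdot> f \<in> Hom D X X" using Comp_Hom p H by blast
    have I: "Id D X \<in> Hom D X X" using Id_Hom o by blast
    have "f \<cdot> d = (f \<cdot> (p \<cdot> f)) \<boxplus> (f \<cdot> Neg D (Id D X))"
      unfolding d_def using Comp_Add[OF pfh Neg_Hom[OF I]] H by blast
    also have "\<dots> = f \<boxplus> Neg D f"
      using Comp_assoc[of f X Y p X f Y] H p ef Comp_Neg[OF I] Comp_Id by metis
    also have "\<dots> = Zero D X Y" using Add_Neg H by blast
    finally have "d = Zero D X X" using f_monic[of d X] Add_Hom pfh Neg_Hom I unfolding d_def by blast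
    then have "Neg D (Id D X) = Neg D (p \<cdot> f)" unfolding d_def using Neg_unique pfh I Neg_Hom by blast
    then show ?thesis using Neg_Neg pfh I by metis
  qed
  have ps: "p \<cdot> s = Zero D Z X"
  proof (rule f_monic)
    show "p \<cdot> s \<in> Hom D Z X" using Comp_Hom p s by blast
    show "f \<cdot> (p \<cdot> s) = Zero D Z Y" using Comp_assoc[OF s(1) p(1)] H es p(2) by metis
  qed
  have sum: "(f \<cdot> p) \<boxplus> (s \<cdot> g) = Id D Y"
  proof -
    have "(f \<cdot> p) \<boxplus> (s \<cdot> g) = Id D Y \<boxplus> (Neg D (s \<cdot> g) \<boxplus> (s \<cdot> g))"
      using p(2) Add_assoc[OF Id_Hom Neg_Hom[OF e1] e1] o unfolding e_def by metis
    also have "\<dots> = Id D Y"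
      using Add_commute[OF Neg_Hom[OF e1] e1] Add_Neg[OF e1] Add_Zero Id_Hom o by metis
    finally show ?thesis .
  qed
  show ?thesis unfolding is_biproduct_def
    using H p(1) s pf ps gf sum by metis
qed

lemma split_off_quotient:
  assumes t: "tri D X Y Z" and z: "no_maps D X Y"
  shows "is_biproduct D Z Y (Sh D X)"
proof -
  obtain f g h where d: "dist_triangle D X Y Z f g h" using t unfolding tri_def by blast
  note o = dist_triangle_objects[OF d]
  have "f = Zero D X Y" using z dist_triangle_Hom[OF d] unfolding no_maps_def by blast
  then have "Neg D (ShArr D f) = Zero D (Sh D X) (Sh D Y)" using ShArr_Zero Neg_Zero Sh_Obj o by metis
  then show ?thesis using split_triangle dist_triangle_rotate[OF d] by metis
qed

text \<open>The connecting map of the rotated triangle \<open>W \<rightarrow> X \<rightarrow> Y \<rightarrow> W[1]\<close> is a map from \<open>Y\<close> to an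
  object isomorphic to \<open>Z\<close>, hence zero.\<close>

lemma split_off_sub:
  assumes t: "tri D X Y Z" and z: "no_maps D Y Z"
  obtains W where "W \<in> Obj D" "isomorphic D (Sh D W) Z" "is_biproduct D X W Y"
proof -
  note o = tri_objects[OF t]
  obtain W where W: "W \<in> Obj D" "isomorphic D (Sh D W) Z" using desuspension o by blast
  have "tri D X Y (Sh D W)"
    using tri_iso[OF t] isomorphic_refl isomorphic_sym W o by blast
  then have "tri D W X Y" using tri_rotate W by blast
  then obtain f g h where d: "dist_triangle D W X Y f g h" unfolding tri_def by blast
  have "no_maps D Y (Sh D W)" using no_maps_iso_right isomorphic_sym z W by blast
  then have "h = Zero D Y (Sh D W)" using dist_triangle_Hom[OF d] unfolding no_maps_def by blast
  then show thesis using that W split_triangle d by blast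
qed

end


section \<open>Orthogonal subcategories and torsion pairs\<close>

definition left_orth :: "('o, 'm, 'z) preadditive_data_scheme \<Rightarrow> 'o set \<Rightarrow> 'o set" where
  "left_orth D \<Y> = {A \<in> Obj D. \<forall>Y\<in>\<Y>. no_maps D A Y}"

definition right_orth :: "('o, 'm, 'z) preadditive_data_scheme \<Rightarrow> 'o set \<Rightarrow> 'o set" where
  "right_orth D \<X> = {B \<in> Obj D. \<forall>X\<in>\<X>. no_maps D X B}"

lemma Hom_vanishes_iff_no_maps:
  "Hom_vanishes D \<X> \<Y> \<longleftrightarrow> (\<forall>X\<in>\<X>. \<forall>Y\<in>\<Y>. no_maps D X Y)"
  by (simp add: Hom_vanishes_def no_maps_def)

lemma additive_summand_closedD:
  assumes "additive_summand_closed D \<K> \<X>"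
  shows "X \<in> \<X> \<Longrightarrow> Y \<in> \<X> \<Longrightarrow> A \<in> Obj D \<Longrightarrow> is_biproduct D A X Y \<Longrightarrow> A \<in> \<X>"
    and "X \<in> \<K> \<Longrightarrow> Y \<in> \<K> \<Longrightarrow> A \<in> \<X> \<Longrightarrow> is_biproduct D A X Y \<Longrightarrow> X \<in> \<X>"
    and "X \<in> \<K> \<Longrightarrow> Y \<in> \<K> \<Longrightarrow> A \<in> \<X> \<Longrightarrow> is_biproduct D A X Y \<Longrightarrow> Y \<in> \<X>"
proof -
  have sum: "\<forall>X\<in>\<X>. \<forall>Y\<in>\<X>. \<forall>A\<in>Obj D. is_biproduct D A X Y \<longrightarrow> A \<in> \<X>"
    and summand: "\<forall>X\<in>\<K>. \<forall>Y\<in>\<K>. \<forall>A\<in>\<X>. is_biproduct D A X Y \<longrightarrow> X \<in> \<X> \<and> Y \<in> \<X>"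
    using assms unfolding additive_summand_closed_def by iprover+
  show "X \<in> \<X> \<Longrightarrow> Y \<in> \<X> \<Longrightarrow> A \<in> Obj D \<Longrightarrow> is_biproduct D A X Y \<Longrightarrow> A \<in> \<X>"
    by (rule sum[THEN bspec, THEN bspec, THEN bspec, THEN mp])
  show "X \<in> \<K> \<Longrightarrow> Y \<in> \<K> \<Longrightarrow> A \<in> \<X> \<Longrightarrow> is_biproduct D A X Y \<Longrightarrow> X \<in> \<X>"
    by (rule summand[THEN bspec, THEN bspec, THEN bspec, THEN mp, THEN conjunct1])
  show "X \<in> \<K> \<Longrightarrow> Y \<in> \<K> \<Longrightarrow> A \<in> \<X> \<Longrightarrow> is_biproduct D A X Y \<Longrightarrow> Y \<in> \<X>"
    by (rule summand[THEN bspec, THEN bspec, THEN bspec, THEN mp, THEN conjunct2])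
qed

context additive_category
begin

lemma zero_objects_isomorphic:
  assumes "is_zero_object D Z" "is_zero_object D Z'"
  shows "isomorphic D Z Z'"
proof -
  have o: "Z \<in> Obj D" "Z' \<in> Obj D" using assms by (auto simp: zero_object_iff_Id)
  have "Zero D Z Z' \<in> Hom D Z Z'" "Zero D Z' Z \<in> Hom D Z' Z" using Zero_Hom o by auto
  moreover have "Zero D Z' Z \<cdot> Zero D Z Z' = Id D Z" "Zero D Z Z' \<cdot> Zero D Z' Z = Id D Z'"
    using Comp_Zero Zero_Hom o assms by (auto simp: zero_object_iff_Id)
  ultimately show ?thesis unfolding isomorphic_def iso_arrow_def by blast
qed

lemma biproduct_trivial_left:
  assumes "is_biproduct D A X Y" "no_maps D A X"
  shows "isomorphic D A Y"
proof -
  obtain i j p q where h: "i \<in> Hom D X A" "j \<in> Hom D Y A" "p \<in> Hom D A X" "q \<in> Hom D A Y"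
    and e: "q \<cdot> j = Id D Y" "(i \<cdot> p) \<boxplus> (j \<cdot> q) = Id D A"
    using assms(1) unfolding is_biproduct_def by blast
  have "p = Zero D A X" using assms(2) h(3) unfolding no_maps_def by blast
  then have "i \<cdot> p = Zero D A A" using Comp_Zero[OF h(1)] Hom_objects[OF h(1)] by simp
  then have "j \<cdot> q = Id D A" using e(2) Zero_Add[OF Comp_Hom[OF h(4,2)]] by simp
  then show ?thesis using h e unfolding isomorphic_def iso_arrow_def by blast
qed

lemma biproduct_trivial_right:
  assumes "is_biproduct D A X Y" "no_maps D Y A"
  shows "isomorphic D A X"
proof -
  obtain i j p q where h: "i \<in> Hom D X A" "j \<in> Hom D Y A" "p \<in> Hom D A X" "q \<in> Hom D A Y"
    and e: "p \<cdot> i = Id D X" "(i \<cdot> p) \<boxplus> (j \<cdot> q) = Id D A"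
    using assms(1) unfolding is_biproduct_def by blast
  have "j = Zero D Y A" using assms(2) h(2) unfolding no_maps_def by blast
  then have "j \<cdot> q = Zero D A A" using Zero_Comp[OF h(4)] Hom_objects[OF h(1)] by simp
  then have "i \<cdot> p = Id D A" using e(2) Add_Zero[OF Comp_Hom[OF h(3,1)]] by simp
  then show ?thesis using h e unfolding isomorphic_def iso_arrow_def by blast
qed

lemma left_orth_closed: "additive_summand_closed D (Obj D) (left_orth D \<Y>)" if "\<Y> \<subseteq> Obj D"
proof -
  obtain Z where "is_zero_object D Z" using zero_object_exists by blast
  then have "\<exists>Z\<in>left_orth D \<Y>. is_zero_object D Z"
    using zero_object_no_maps that unfolding left_orth_def is_zero_object_def by blast
  then show ?thesis
    unfolding additive_summand_closed_def iso_closed_subcat_def left_orth_def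
    using no_maps_iso_left no_maps_biproduct_left by blast
qed

lemma right_orth_closed: "additive_summand_closed D (Obj D) (right_orth D \<X>)" if "\<X> \<subseteq> Obj D"
proof -
  obtain Z where "is_zero_object D Z" using zero_object_exists by blast
  then have "\<exists>Z\<in>right_orth D \<X>. is_zero_object D Z"
    using zero_object_no_maps that unfolding right_orth_def is_zero_object_def by blast
  then show ?thesis
    unfolding additive_summand_closed_def iso_closed_subcat_def right_orth_def
    using no_maps_iso_right no_maps_biproduct_right by blast
qed

lemma additive_summand_closed_Int:
  assumes \<X>: "additive_summand_closed D (Obj D) \<X>" and \<Y>: "additive_summand_closed D (Obj D) \<Y>"
    and \<K>: "\<X> \<inter> \<Y> \<subseteq> \<K>" "\<K> \<subseteq> Obj D"
  shows "additive_summand_closed D \<K> (\<X> \<inter> \<Y>)"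
proof -
  have iso: "iso_closed_subcat D \<X>" "iso_closed_subcat D \<Y>"
    using \<X> \<Y> unfolding additive_summand_closed_def by simp_all
  obtain Z where Z: "Z \<in> \<X>" "is_zero_object D Z"
    using \<X> unfolding additive_summand_closed_def by auto
  obtain Z' where Z': "Z' \<in> \<Y>" "is_zero_object D Z'"
    using \<Y> unfolding additive_summand_closed_def by auto
  have "Z \<in> \<Y>" by (rule iso_closed_subcatD[OF iso(2) Z'(1) zero_objects_isomorphic[OF Z'(2) Z(2)]])
  with Z have zero: "\<exists>Z\<in>\<X> \<inter> \<Y>. is_zero_object D Z" by blast
  have iso_Int: "iso_closed_subcat D (\<X> \<inter> \<Y>)"
    using iso unfolding iso_closed_subcat_def by auto
  have sum: "A \<in> \<X> \<inter> \<Y>" if "X \<in> \<X> \<inter> \<Y>" "Y \<in> \<X> \<inter> \<Y>" "A \<in> Obj D" "is_biproduct D A X Y" for X Y A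
    using additive_summand_closedD(1)[OF \<X> _ _ that(3,4)]
      additive_summand_closedD(1)[OF \<Y> _ _ that(3,4)] that(1,2) by simp
  have summand: "X \<in> \<X> \<inter> \<Y> \<and> Y \<in> \<X> \<inter> \<Y>"
    if "X \<in> \<K>" "Y \<in> \<K>" "A \<in> \<X> \<inter> \<Y>" "is_biproduct D A X Y" for X Y A
  proof -
    have o: "X \<in> Obj D" "Y \<in> Obj D" using that \<K>(2) by auto
    show ?thesis
      using additive_summand_closedD(2,3)[OF \<X> o _ that(4)]
        additive_summand_closedD(2,3)[OF \<Y> o _ that(4)] that(3) by simp
  qed
  show ?thesis
    unfolding additive_summand_closed_def
  proof (intro conjI)
    show "\<forall>X\<in>\<X> \<inter> \<Y>. \<forall>Y\<in>\<X> \<inter> \<Y>. \<forall>A\<in>Obj D. is_biproduct D A X Y \<longrightarrow> A \<in> \<X> \<inter> \<Y>"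
      by (intro ballI impI) (rule sum)
    show "\<forall>X\<in>\<K>. \<forall>Y\<in>\<K>. \<forall>A\<in>\<X> \<inter> \<Y>. is_biproduct D A X Y \<longrightarrow> X \<in> \<X> \<inter> \<Y> \<and> Y \<in> \<X> \<inter> \<Y>"
      by (intro ballI impI) (rule summand)
  qed (fact \<K>(1) iso_Int zero)+
qed

end

context triangulated_category
begin

lemma torsion_pair_decomposition:
  assumes "torsion_pair D \<K> (\<T>, \<F>)" "X \<in> \<K>"
  obtains T F where "T \<in> \<T>" "F \<in> \<F>" "tri D T X F"
proof -
  have "\<exists>T\<in>\<T>. \<exists>F\<in>\<F>. tri D T X F"
    using assms unfolding torsion_pair_def tri_def by simp
  then show thesis using that by blast
qed

lemma torsion_pair_no_maps:
  "torsion_pair D \<K> (\<T>, \<F>) \<Longrightarrow> T \<in> \<T> \<Longrightarrow> F \<in> \<F> \<Longrightarrow> no_maps D T F"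
  unfolding torsion_pair_def by (simp add: Hom_vanishes_iff_no_maps)

lemma torsion_pair_closed:
  assumes "torsion_pair D \<K> (\<T>, \<F>)"
  shows "additive_summand_closed D \<K> \<T>" "additive_summand_closed D \<K> \<F>"
    "iso_closed_subcat D \<T>" "iso_closed_subcat D \<F>" "\<T> \<subseteq> Obj D" "\<F> \<subseteq> Obj D" "\<T> \<subseteq> \<K>" "\<F> \<subseteq> \<K>"
proof -
  show c: "additive_summand_closed D \<K> \<T>" "additive_summand_closed D \<K> \<F>"
    using assms unfolding torsion_pair_def by simp_all
  show i: "iso_closed_subcat D \<T>" "iso_closed_subcat D \<F>" and "\<T> \<subseteq> \<K>" "\<F> \<subseteq> \<K>"
    using c unfolding additive_summand_closed_def by iprover+
  show "\<T> \<subseteq> Obj D" "\<F> \<subseteq> Obj D" using i unfolding iso_closed_subcat_def by iprover+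
qed

text \<open>The triangle \<open>T \<rightarrow> A \<rightarrow> F\<close> splits, so \<open>A\<close> is a summand of \<open>T\<close> with complement \<open>F[-1]\<close>. Closure
  under summands is taken within \<open>\<K>\<close>, so the complement has to lie in \<open>\<K>\<close>; this is the last
  premise, since the reason for it depends on \<open>\<K>\<close>.\<close>

lemma torsion_memberI:
  assumes tp: "torsion_pair D \<K> (\<T>, \<F>)" and A: "A \<in> \<K>" "\<And>F. F \<in> \<F> \<Longrightarrow> no_maps D A F"
    and compl: "\<And>T W. T \<in> \<T> \<Longrightarrow> W \<in> Obj D \<Longrightarrow> Sh D W \<in> \<F> \<Longrightarrow> is_biproduct D T W A \<Longrightarrow> W \<in> \<K>"
  shows "A \<in> \<T>"
proof -
  obtain T F where TF: "T \<in> \<T>" "F \<in> \<F>" "tri D T A F"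
    using torsion_pair_decomposition[OF tp A(1)] .
  obtain W where W: "W \<in> Obj D" "isomorphic D (Sh D W) F" "is_biproduct D T W A"
    using split_off_sub[OF TF(3) A(2)[OF TF(2)]] .
  have "Sh D W \<in> \<F>"
    using iso_closed_subcatD torsion_pair_closed[OF tp] isomorphic_sym W TF by blast
  then have "W \<in> \<K>" using compl TF W by blast
  then show ?thesis
    using additive_summand_closedD(3)[OF torsion_pair_closed(1)[OF tp] _ A(1) TF(1) W(3)] by blast
qed

text \<open>Here \<open>A\<close> is a summand of \<open>F\<close> with complement \<open>T[1]\<close>.\<close>

lemma torsion_free_memberI:
  assumes tp: "torsion_pair D \<K> (\<T>, \<F>)" and A: "A \<in> \<K>" "\<And>T. T \<in> \<T> \<Longrightarrow> no_maps D T A"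
    and compl: "\<And>T F. T \<in> \<T> \<Longrightarrow> F \<in> \<F> \<Longrightarrow> is_biproduct D F A (Sh D T) \<Longrightarrow> Sh D T \<in> \<K>"
  shows "A \<in> \<F>"
proof -
  obtain T F where TF: "T \<in> \<T>" "F \<in> \<F>" "tri D T A F"
    using torsion_pair_decomposition[OF tp A(1)] .
  have b: "is_biproduct D F A (Sh D T)" using split_off_quotient[OF TF(3) A(2)[OF TF(1)]] .
  then have "Sh D T \<in> \<K>" using compl TF by blast
  then show ?thesis
    using additive_summand_closedD(2)[OF torsion_pair_closed(2)[OF tp] A(1) _ TF(2) b] by blast
qed

lemma torsion_pair_orthogonal:
  assumes tp: "torsion_pair D (Obj D) (\<U>, \<V>)"
  shows "\<U> = left_orth D \<V>" "\<V> = right_orth D \<U>"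
proof -
  note c = torsion_pair_closed[OF tp] and n = torsion_pair_no_maps[OF tp]
  show "\<U> = left_orth D \<V>"
    using torsion_memberI[OF tp] c n unfolding left_orth_def by blast
  have "A \<in> \<V>" if "A \<in> right_orth D \<U>" for A
    by (rule torsion_free_memberI[OF tp]) (use that c Sh_Obj in \<open>auto simp: right_orth_def\<close>)
  then show "\<V> = right_orth D \<U>" using c n unfolding right_orth_def by blast
qed

lemma torsion_pairI_orth:
  assumes "\<U> = left_orth D \<V>" "\<V> = right_orth D \<U>"
    and "\<And>X. X \<in> Obj D \<Longrightarrow> \<exists>U\<in>\<U>. \<exists>V\<in>\<V>. tri D U X V"
  shows "torsion_pair D (Obj D) (\<U>, \<V>)"
proof -
  have o: "\<U> \<subseteq> Obj D" "\<V> \<subseteq> Obj D"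
    using assms(1) assms(2) unfolding left_orth_def right_orth_def by blast+
  have "additive_summand_closed D (Obj D) \<U>" using left_orth_closed[OF o(2)] assms(1) by simp
  moreover have "additive_summand_closed D (Obj D) \<V>" using right_orth_closed[OF o(1)] assms(2) by simp
  moreover have "\<forall>X\<in>\<U>. \<forall>Y\<in>\<V>. no_maps D X Y" using assms(1) unfolding left_orth_def by blast
  ultimately show ?thesis
    unfolding torsion_pair_def using assms(3) by (auto simp: Hom_vanishes_iff_no_maps tri_def)
qed


text \<open>Maps into \<open>Y[-1]\<close> are replaced by maps from \<open>X[1]\<close>, so that no inverse of the shift has to be
  handled later.\<close>

lemma Hom_vanishes_shift_down:
  assumes "\<X> \<subseteq> Obj D" "iso_closed_subcat D \<Y>"
  shows "Hom_vanishes D \<X> (shift_down D \<Y>) \<longleftrightarrow> (\<forall>X\<in>\<X>. \<forall>Y\<in>\<Y>. no_maps D (Sh D X) Y)"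
proof
  assume v: "Hom_vanishes D \<X> (shift_down D \<Y>)"
  show "\<forall>X\<in>\<X>. \<forall>Y\<in>\<Y>. no_maps D (Sh D X) Y"
  proof (intro ballI)
    fix X Y assume XY: "X \<in> \<X>" "Y \<in> \<Y>"
    have Y: "Y \<in> Obj D" using XY assms(2) unfolding iso_closed_subcat_def by blast
    obtain W where W: "W \<in> Obj D" "isomorphic D (Sh D W) Y" using desuspension[OF Y] .
    have "Sh D W \<in> \<Y>" by (rule iso_closed_subcatD[OF assms(2) XY(2) isomorphic_sym[OF W(2)]])
    then have "no_maps D X W"
      using v XY W(1) unfolding Hom_vanishes_iff_no_maps shift_down_def by blast
    then have "no_maps D (Sh D X) (Sh D W)" using no_maps_Sh[of X W] W(1) XY(1) assms(1) by blast
    then show "no_maps D (Sh D X) Y" by (rule no_maps_iso_right[OF W(2)])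
  qed
next
  assume v: "\<forall>X\<in>\<X>. \<forall>Y\<in>\<Y>. no_maps D (Sh D X) Y"
  have "no_maps D X W" if "X \<in> \<X>" "W \<in> shift_down D \<Y>" for X W
    using that v no_maps_Sh[of X W] assms(1) by (auto simp: shift_down_def)
  then show "Hom_vanishes D \<X> (shift_down D \<Y>)" unfolding Hom_vanishes_iff_no_maps by blast
qed

lemma tors_prec_iff:
  assumes "\<T> \<subseteq> Obj D" "iso_closed_subcat D \<F>'"
  shows "tors_prec D (\<T>, \<F>) (\<T>', \<F>') \<longleftrightarrow>
    (\<forall>X\<in>\<T>. \<forall>Y\<in>\<F>'. no_maps D X Y \<and> no_maps D (Sh D X) Y)"
  unfolding tors_prec_def using Hom_vanishes_shift_down[OF assms]
  by (auto simp: Hom_vanishes_iff_no_maps)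


section \<open>t-structures as shift-closed torsion pairs\<close>

lemma iso_closed_shift_down: "iso_closed_subcat D \<G> \<Longrightarrow> iso_closed_subcat D (shift_down D \<G>)"
  unfolding iso_closed_subcat_def shift_down_def using isomorphic_Sh Sh_Obj by blast

lemma iso_closed_shift_up: "iso_closed_subcat D (shift_up D \<X>)"
  unfolding iso_closed_subcat_def shift_up_def using isomorphic_trans by blast

lemma shift_up_shift_down: "iso_closed_subcat D \<G> \<Longrightarrow> shift_up D (shift_down D \<G>) = \<G>"
proof -
  assume G: "iso_closed_subcat D \<G>"
  have "A \<in> shift_up D (shift_down D \<G>)" if A: "A \<in> \<G>" for A
  proof -
    have o: "A \<in> Obj D" using A G unfolding iso_closed_subcat_def by blast
    then obtain W where W: "W \<in> Obj D" "isomorphic D (Sh D W) A" using desuspension by blast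
    then have "Sh D W \<in> \<G>" using iso_closed_subcatD G A isomorphic_sym by blast
    then show ?thesis unfolding shift_up_def shift_down_def using W o by blast
  qed
  then show ?thesis using iso_closed_subcatD[OF G] unfolding shift_up_def shift_down_def by blast
qed

lemma shift_down_shift_up: "iso_closed_subcat D \<X> \<Longrightarrow> shift_down D (shift_up D \<X>) = \<X>"
proof -
  assume X: "iso_closed_subcat D \<X>"
  have "A \<in> \<X>" if "A \<in> shift_down D (shift_up D \<X>)" for A
  proof -
    obtain B where B: "A \<in> Obj D" "B \<in> \<X>" "isomorphic D (Sh D B) (Sh D A)"
      using \<open>A \<in> shift_down D (shift_up D \<X>)\<close> unfolding shift_up_def shift_down_def by blast
    then have "B \<in> Obj D" using X unfolding iso_closed_subcat_def by blast
    then show ?thesis using B isomorphic_Sh iso_closed_subcatD[OF X] by blast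
  qed
  moreover have "A \<in> shift_down D (shift_up D \<X>)" if "A \<in> \<X>" for A
    using that X Sh_Obj isomorphic_refl[OF Sh_Obj] unfolding shift_up_def shift_down_def iso_closed_subcat_def
    by blast
  ultimately show ?thesis by blast
qed

lemma star_shift_up:
  assumes "iso_closed_subcat D \<X>" "iso_closed_subcat D \<Y>"
  shows "star D (shift_up D \<X>) (shift_up D \<Y>) = shift_up D (star D \<X> \<Y>)"
proof -
  have X: "\<X> \<subseteq> Obj D" and Y: "\<Y> \<subseteq> Obj D" using assms unfolding iso_closed_subcat_def by auto
  have star: "A \<in> star D \<X>' \<Y>' \<longleftrightarrow> (\<exists>X\<in>\<X>'. \<exists>Y\<in>\<Y>'. tri D X A Y)" for A \<X>' \<Y>'
    using tri_objects unfolding star_def tri_def by blast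
  show ?thesis
  proof (intro subset_antisym subsetI)
    fix A assume "A \<in> star D (shift_up D \<X>) (shift_up D \<Y>)"
    then obtain P Q B C where h: "B \<in> \<X>" "C \<in> \<Y>" "isomorphic D (Sh D B) P" "isomorphic D (Sh D C) Q"
      "tri D P A Q" unfolding star shift_up_def by blast
    have o: "A \<in> Obj D" "B \<in> Obj D" "C \<in> Obj D" using tri_objects h X Y by blast+
    obtain W where W: "W \<in> Obj D" "isomorphic D (Sh D W) A" using desuspension[OF o(1)] .
    have "tri D (Sh D B) (Sh D W) (Sh D C)" using tri_iso[OF h(5)] h W isomorphic_sym by blast
    then have "tri D B W C" using tri_Sh o W by blast
    then have "W \<in> star D \<X> \<Y>" unfolding star using h by blast
    then show "A \<in> shift_up D (star D \<X> \<Y>)" unfolding shift_up_def using W o by blast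
  next
    fix A assume "A \<in> shift_up D (star D \<X> \<Y>)"
    then obtain W B C where h: "A \<in> Obj D" "B \<in> \<X>" "C \<in> \<Y>" "tri D B W C" "isomorphic D (Sh D W) A"
      using star[of _ \<X> \<Y>] unfolding shift_up_def by blast
    note o = tri_objects[OF h(4)]
    have "tri D (Sh D B) (Sh D W) (Sh D C)" using tri_Sh o h(4) by blast
    then have "tri D (Sh D B) A (Sh D C)" using tri_iso isomorphic_refl Sh_Obj o h(5) by blast
    moreover have "Sh D B \<in> shift_up D \<X>" "Sh D C \<in> shift_up D \<Y>"
      unfolding shift_up_def using h isomorphic_refl Sh_Obj o by blast+
    ultimately show "A \<in> star D (shift_up D \<X>) (shift_up D \<Y>)" unfolding star by blast
  qed
qed

text \<open>For a shift-closed \<open>\<L>\<close>, closure under summands comes for free: the complement split off from a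
  truncation admits no maps from (or to) the truncation, so it vanishes and the truncation map is
  an isomorphism.\<close>

lemma torsion_pairI_shift_closed:
  assumes "iso_closed_subcat D \<L>" "iso_closed_subcat D \<V>"
    and van: "\<And>X Y. X \<in> \<L> \<Longrightarrow> Y \<in> \<V> \<Longrightarrow> no_maps D X Y"
    and dec: "\<And>X. X \<in> Obj D \<Longrightarrow> \<exists>U\<in>\<L>. \<exists>V\<in>\<V>. tri D U X V"
    and sh: "\<And>X. X \<in> \<L> \<Longrightarrow> Sh D X \<in> \<L>"
  shows "torsion_pair D (Obj D) (\<L>, \<V>)"
proof (rule torsion_pairI_orth[OF _ _ dec])
  have o: "\<L> \<subseteq> Obj D" "\<V> \<subseteq> Obj D" using assms(1,2) unfolding iso_closed_subcat_def by auto
  have "A \<in> \<L>" if A: "A \<in> left_orth D \<V>" for A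
  proof -
    have A': "A \<in> Obj D" "\<And>Y. Y \<in> \<V> \<Longrightarrow> no_maps D A Y" using A unfolding left_orth_def by auto
    obtain U V where UV: "U \<in> \<L>" "V \<in> \<V>" "tri D U A V" using dec A'(1) by blast
    obtain W where W: "W \<in> Obj D" "isomorphic D (Sh D W) V" "is_biproduct D U W A"
      using split_off_sub[OF UV(3) A'(2)[OF UV(2)]] .
    have "no_maps D (Sh D U) (Sh D W)"
      using no_maps_iso_right[OF isomorphic_sym[OF W(2)] van[OF sh[OF UV(1)] UV(2)]] .
    then have "no_maps D U W" using no_maps_Sh[of U W] UV(1) o W(1) by blast
    then have "isomorphic D U A" using biproduct_trivial_left W(3) by blast
    then show ?thesis using iso_closed_subcatD assms(1) UV(1) by blast
  qed
  then show "\<L> = left_orth D \<V>" using van o unfolding left_orth_def by blast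
  have "A \<in> \<V>" if A: "A \<in> right_orth D \<L>" for A
  proof -
    have A': "A \<in> Obj D" "\<And>X. X \<in> \<L> \<Longrightarrow> no_maps D X A" using A unfolding right_orth_def by auto
    obtain U V where UV: "U \<in> \<L>" "V \<in> \<V>" "tri D U A V" using dec A'(1) by blast
    have "is_biproduct D V A (Sh D U)" using split_off_quotient[OF UV(3) A'(2)[OF UV(1)]] .
    then have "isomorphic D V A" using biproduct_trivial_right van[OF sh[OF UV(1)] UV(2)] by blast
    then show ?thesis using iso_closed_subcatD assms(2) UV(2) by blast
  qed
  then show "\<V> = right_orth D \<L>" using van o unfolding right_orth_def by blast
qed

lemma t_structure_iff:
  "t_structure D (\<L>, \<G>) \<longleftrightarrow> iso_closed_subcat D \<G> \<and>
     torsion_pair D (Obj D) (\<L>, shift_down D \<G>) \<and> (\<forall>X\<in>\<L>. Sh D X \<in> \<L>)"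
proof
  assume t: "t_structure D (\<L>, \<G>)"
  then have G: "iso_closed_subcat D \<G>" and L: "iso_closed_subcat D \<L>"
    and v: "\<And>X Y. X \<in> \<L> \<Longrightarrow> Y \<in> shift_down D \<G> \<Longrightarrow> no_maps D X Y"
    and O: "Obj D = star D \<L> (shift_down D \<G>)"
    and s: "\<And>X. X \<in> \<L> \<Longrightarrow> Sh D X \<in> \<L>"
    unfolding t_structure_def by (auto simp: Hom_vanishes_iff_no_maps shift_down_def)
  have "\<exists>U\<in>\<L>. \<exists>V\<in>shift_down D \<G>. tri D U X V" if "X \<in> Obj D" for X
    using that O unfolding star_def tri_def by blast
  then have "torsion_pair D (Obj D) (\<L>, shift_down D \<G>)"
    using torsion_pairI_shift_closed[OF L iso_closed_shift_down[OF G] v _ s] by blast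
  then show "iso_closed_subcat D \<G> \<and>
     torsion_pair D (Obj D) (\<L>, shift_down D \<G>) \<and> (\<forall>X\<in>\<L>. Sh D X \<in> \<L>)" using G s by blast
next
  assume "iso_closed_subcat D \<G> \<and>
     torsion_pair D (Obj D) (\<L>, shift_down D \<G>) \<and> (\<forall>X\<in>\<L>. Sh D X \<in> \<L>)"
  then have G: "iso_closed_subcat D \<G>" and tp: "torsion_pair D (Obj D) (\<L>, shift_down D \<G>)"
    and s: "\<And>X. X \<in> \<L> \<Longrightarrow> Sh D X \<in> \<L>" by auto
  note c = torsion_pair_closed[OF tp] and n = torsion_pair_no_maps[OF tp]
  have "A \<in> star D \<L> (shift_down D \<G>)" if A: "A \<in> Obj D" for A
  proof -
    obtain U V where "U \<in> \<L>" "V \<in> shift_down D \<G>" "tri D U A V"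
      using torsion_pair_decomposition[OF tp A] .
    then show ?thesis using A unfolding star_def tri_def by blast
  qed
  then have "Obj D = star D \<L> (shift_down D \<G>)" unfolding star_def by auto
  moreover have "A \<in> \<G>" if A: "A \<in> shift_down D \<G>" for A
  proof -
    have o: "A \<in> Obj D" using A c by blast
    obtain W where W: "W \<in> Obj D" "isomorphic D (Sh D W) A" using desuspension[OF o] .
    have "no_maps D X W" if X: "X \<in> \<L>" for X
    proof -
      have "no_maps D (Sh D X) (Sh D W)"
        using no_maps_iso_right[OF isomorphic_sym[OF W(2)] n[OF s[OF X] A]] .
      then show ?thesis using no_maps_Sh[of X W] X c W(1) by blast
    qed
    then have "W \<in> shift_down D \<G>" using torsion_pair_orthogonal(2)[OF tp] W(1)
      unfolding right_orth_def by blast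
    then show ?thesis using W G iso_closed_subcatD unfolding shift_down_def by blast
  qed
  moreover have "\<L> \<subseteq> shift_down D \<L>" using s c unfolding shift_down_def by blast
  ultimately show "t_structure D (\<L>, \<G>)"
    unfolding t_structure_def using G c n by (auto simp: Hom_vanishes_iff_no_maps)
qed

end


section \<open>Intervals of torsion pairs\<close>

lemma inverse_order_bijectionsI:
  assumes "\<And>a. a \<in> A \<Longrightarrow> \<Phi> a \<in> B" "\<And>b. b \<in> B \<Longrightarrow> \<Psi> b \<in> A"
    and "\<And>a. a \<in> A \<Longrightarrow> \<Psi> (\<Phi> a) = a" "\<And>b. b \<in> B \<Longrightarrow> \<Phi> (\<Psi> b) = b"
    and "\<And>a a'. a \<in> A \<Longrightarrow> a' \<in> A \<Longrightarrow> le\<^sub>A a a' \<Longrightarrow> le\<^sub>B (\<Phi> a) (\<Phi> a')"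
    and "\<And>b b'. b \<in> B \<Longrightarrow> b' \<in> B \<Longrightarrow> le\<^sub>B b b' \<Longrightarrow> le\<^sub>A (\<Psi> b) (\<Psi> b')"
  shows "inverse_order_bijections A le\<^sub>A B le\<^sub>B \<Phi> \<Psi>"
proof -
  have "bij_betw \<Phi> A B" by (rule bij_betw_byWitness[of A \<Psi>]) (use assms in auto)
  moreover have "bij_betw \<Psi> B A" by (rule bij_betw_byWitness[of B \<Phi>]) (use assms in auto)
  ultimately show ?thesis unfolding inverse_order_bijections_def monotone_on_def using assms by blast
qed

locale torsion_interval = triangulated_category D
  for D :: "('o, 'm, 'z) triangulated_data_scheme" (structure) +
  fixes \<U>\<^sub>1 \<V>\<^sub>1 \<U>\<^sub>2 \<V>\<^sub>2 :: "'o set"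
  assumes lower: "torsion_pair D (Obj D) (\<U>\<^sub>1, \<V>\<^sub>1)"
    and upper: "torsion_pair D (Obj D) (\<U>\<^sub>2, \<V>\<^sub>2)"
    and lower_le_upper: "\<U>\<^sub>1 \<subseteq> \<U>\<^sub>2"
    and lower_shift_le_upper: "shift_up D \<U>\<^sub>1 \<subseteq> \<U>\<^sub>2"
begin

lemma objects: "\<U>\<^sub>1 \<subseteq> Obj D" "\<V>\<^sub>1 \<subseteq> Obj D" "\<U>\<^sub>2 \<subseteq> Obj D" "\<V>\<^sub>2 \<subseteq> Obj D"
  using torsion_pair_closed[OF lower] torsion_pair_closed[OF upper] by auto

lemma iso_closed: "iso_closed_subcat D \<U>\<^sub>1" "iso_closed_subcat D \<V>\<^sub>1"
    "iso_closed_subcat D \<U>\<^sub>2" "iso_closed_subcat D \<V>\<^sub>2"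
  using torsion_pair_closed[OF lower] torsion_pair_closed[OF upper] by auto

lemma V1_iff: "A \<in> \<V>\<^sub>1 \<longleftrightarrow> A \<in> Obj D \<and> (\<forall>X\<in>\<U>\<^sub>1. no_maps D X A)"
  using torsion_pair_orthogonal(2)[OF lower] unfolding right_orth_def by blast

lemma U2_iff: "A \<in> \<U>\<^sub>2 \<longleftrightarrow> A \<in> Obj D \<and> (\<forall>Y\<in>\<V>\<^sub>2. no_maps D A Y)"
  using torsion_pair_orthogonal(1)[OF upper] unfolding left_orth_def by blast

lemma shift_up_subset_U2:
  assumes "\<X> \<subseteq> Obj D"
  shows "shift_up D \<X> \<subseteq> \<U>\<^sub>2 \<longleftrightarrow> (\<forall>X\<in>\<X>. \<forall>Y\<in>\<V>\<^sub>2. no_maps D (Sh D X) Y)"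
proof -
  have "shift_up D \<X> \<subseteq> \<U>\<^sub>2 \<longleftrightarrow> (\<forall>X\<in>\<X>. Sh D X \<in> \<U>\<^sub>2)"
    using iso_closed_subcatD[OF iso_closed(3)] isomorphic_refl Sh_Obj assms
    unfolding shift_up_def by blast
  then show ?thesis using U2_iff Sh_Obj assms by blast
qed

lemma shift_down_subset_V1:
  assumes "iso_closed_subcat D \<Y>"
  shows "shift_down D \<Y> \<subseteq> \<V>\<^sub>1 \<longleftrightarrow> (\<forall>X\<in>\<U>\<^sub>1. \<forall>Y\<in>\<Y>. no_maps D (Sh D X) Y)"
proof -
  have "shift_down D \<Y> \<subseteq> \<V>\<^sub>1 \<longleftrightarrow> Hom_vanishes D \<U>\<^sub>1 (shift_down D \<Y>)"
    unfolding Hom_vanishes_iff_no_maps using V1_iff by (auto simp: shift_down_def)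
  also have "\<dots> \<longleftrightarrow> (\<forall>X\<in>\<U>\<^sub>1. \<forall>Y\<in>\<Y>. no_maps D (Sh D X) Y)"
    by (rule Hom_vanishes_shift_down) (use assms objects in auto)
  finally show ?thesis .
qed

lemma U1_V1: "X \<in> \<U>\<^sub>1 \<Longrightarrow> Y \<in> \<V>\<^sub>1 \<Longrightarrow> no_maps D X Y"
  using V1_iff by blast

lemma U2_V2: "X \<in> \<U>\<^sub>2 \<Longrightarrow> Y \<in> \<V>\<^sub>2 \<Longrightarrow> no_maps D X Y"
  using U2_iff by blast

lemma U1_V2: "X \<in> \<U>\<^sub>1 \<Longrightarrow> Y \<in> \<V>\<^sub>2 \<Longrightarrow> no_maps D X Y"
  using U2_V2 lower_le_upper by blast

lemma shift_U1_V2: "X \<in> \<U>\<^sub>1 \<Longrightarrow> Y \<in> \<V>\<^sub>2 \<Longrightarrow> no_maps D (Sh D X) Y"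
  using shift_up_subset_U2[OF objects(1)] lower_shift_le_upper by blast

lemma tors_interval_iff:
  "(\<U>, \<V>) \<in> tors_interval D (\<U>\<^sub>1, \<V>\<^sub>1) (\<U>\<^sub>2, \<V>\<^sub>2) \<longleftrightarrow>
    torsion_pair D (Obj D) (\<U>, \<V>) \<and>
    (\<forall>X\<in>\<U>\<^sub>1. \<forall>Y\<in>\<V>. no_maps D X Y \<and> no_maps D (Sh D X) Y) \<and>
    (\<forall>X\<in>\<U>. \<forall>Y\<in>\<V>\<^sub>2. no_maps D X Y \<and> no_maps D (Sh D X) Y)"
  unfolding tors_interval_def
  using tors_prec_iff[OF objects(1), of \<V> \<V>\<^sub>1 \<U>] tors_prec_iff[of \<U> \<V>\<^sub>2 \<V> \<U>\<^sub>2] iso_closed(4)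
    torsion_pair_closed(4,5)[of "Obj D" \<U> \<V>] by auto

lemma tors_tilde_iff:
  "(\<T>, \<F>) \<in> tors_tilde D (\<U>\<^sub>1, \<V>\<^sub>1) (\<U>\<^sub>2, \<V>\<^sub>2) \<longleftrightarrow>
    torsion_pair D (\<U>\<^sub>2 \<inter> \<V>\<^sub>1) (\<T>, \<F>) \<and>
    (\<forall>X\<in>\<T>. \<forall>Y\<in>\<V>\<^sub>2. no_maps D (Sh D X) Y) \<and>
    (\<forall>X\<in>\<U>\<^sub>1. \<forall>Y\<in>\<F>. no_maps D (Sh D X) Y)"
  unfolding tors_tilde_def interval_heart_def
  using shift_up_subset_U2[of \<T>] shift_down_subset_V1[of \<F>]
    torsion_pair_closed(4,5)[of "\<U>\<^sub>2 \<inter> \<V>\<^sub>1" \<T> \<F>] by auto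

text \<open>Both terms of the decomposition \<open>T \<rightarrow> X \<rightarrow> F\<close> of an object of the heart lie in the heart:
  \<open>T\<close> receives no maps from \<open>\<U>\<^sub>1\<close> because neither \<open>X\<close> nor \<open>F[-1]\<close> does, and \<open>F\<close> admits no
  maps to \<open>\<V>\<^sub>2\<close> because neither \<open>X\<close> nor \<open>T[1]\<close> does.\<close>

lemma restriction_in_heart:
  assumes "(\<U>, \<V>) \<in> tors_interval D (\<U>\<^sub>1, \<V>\<^sub>1) (\<U>\<^sub>2, \<V>\<^sub>2)"
  shows "(\<U> \<inter> \<V>\<^sub>1, \<V> \<inter> \<U>\<^sub>2) \<in> tors_tilde D (\<U>\<^sub>1, \<V>\<^sub>1) (\<U>\<^sub>2, \<V>\<^sub>2)"
proof -
  have tp: "torsion_pair D (Obj D) (\<U>, \<V>)"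
    and l: "\<And>X Y. X \<in> \<U>\<^sub>1 \<Longrightarrow> Y \<in> \<V> \<Longrightarrow> no_maps D X Y \<and> no_maps D (Sh D X) Y"
    and u: "\<And>X Y. X \<in> \<U> \<Longrightarrow> Y \<in> \<V>\<^sub>2 \<Longrightarrow> no_maps D X Y \<and> no_maps D (Sh D X) Y"
    using assms unfolding tors_interval_iff by auto
  note c = torsion_pair_closed[OF tp]
  have sub: "\<U> \<subseteq> \<U>\<^sub>2" "\<V> \<subseteq> \<V>\<^sub>1" using U2_iff V1_iff u l c by blast+
  have "\<exists>T\<in>\<U> \<inter> \<V>\<^sub>1. \<exists>F\<in>\<V> \<inter> \<U>\<^sub>2. tri D T X F" if X: "X \<in> \<U>\<^sub>2 \<inter> \<V>\<^sub>1" for X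
  proof -
    obtain T F where TF: "T \<in> \<U>" "F \<in> \<V>" "tri D T X F"
      using torsion_pair_decomposition[OF tp] X objects by blast
    have "no_maps D W T" if "W \<in> \<U>\<^sub>1" for W
      using no_maps_to_cocone[OF TF(3)] that U1_V1 X l TF objects by blast
    then have "T \<in> \<V>\<^sub>1" using V1_iff TF c by blast
    moreover have "no_maps D F W" if "W \<in> \<V>\<^sub>2" for W
      using no_maps_from_cone[OF TF(3)] that U2_V2 X u TF by blast
    then have "F \<in> \<U>\<^sub>2" using U2_iff TF c by blast
    ultimately show ?thesis using TF by blast
  qed
  moreover have "additive_summand_closed D (\<U>\<^sub>2 \<inter> \<V>\<^sub>1) (\<U> \<inter> \<V>\<^sub>1)"
    by (rule additive_summand_closed_Int[OF c(1) torsion_pair_closed(2)[OF lower]])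
      (use sub objects in auto)
  moreover have "additive_summand_closed D (\<U>\<^sub>2 \<inter> \<V>\<^sub>1) (\<V> \<inter> \<U>\<^sub>2)"
    by (rule additive_summand_closed_Int[OF c(2) torsion_pair_closed(1)[OF upper]])
      (use sub objects in auto)
  ultimately have "torsion_pair D (\<U>\<^sub>2 \<inter> \<V>\<^sub>1) (\<U> \<inter> \<V>\<^sub>1, \<V> \<inter> \<U>\<^sub>2)"
    unfolding torsion_pair_def tri_def
    using torsion_pair_no_maps[OF tp] by (auto simp: Hom_vanishes_iff_no_maps)
  then show ?thesis unfolding tors_tilde_iff using l u by blast
qed

section \<open>Extending torsion pairs of the heart\<close>

context
  fixes \<T> \<F>
  assumes tilde: "(\<T>, \<F>) \<in> tors_tilde D (\<U>\<^sub>1, \<V>\<^sub>1) (\<U>\<^sub>2, \<V>\<^sub>2)"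
begin

lemma heart_pair: "torsion_pair D (\<U>\<^sub>2 \<inter> \<V>\<^sub>1) (\<T>, \<F>)"
  using tilde unfolding tors_tilde_iff by blast

lemma shift_T_V2: "X \<in> \<T> \<Longrightarrow> Y \<in> \<V>\<^sub>2 \<Longrightarrow> no_maps D (Sh D X) Y"
  using tilde unfolding tors_tilde_iff by blast

lemma shift_U1_F: "X \<in> \<U>\<^sub>1 \<Longrightarrow> Y \<in> \<F> \<Longrightarrow> no_maps D (Sh D X) Y"
  using tilde unfolding tors_tilde_iff by blast

lemmas T_F = torsion_pair_no_maps[OF heart_pair]

lemma in_heart: "\<T> \<subseteq> \<U>\<^sub>2" "\<T> \<subseteq> \<V>\<^sub>1" "\<F> \<subseteq> \<U>\<^sub>2" "\<F> \<subseteq> \<V>\<^sub>1" "\<T> \<subseteq> Obj D" "\<F> \<subseteq> Obj D"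
  using torsion_pair_closed[OF heart_pair] by auto

text \<open>The complement \<open>W\<close> of \<open>A\<close> in a torsion object lies in the heart: it is in \<open>\<U>\<^sub>2\<close> as a summand
  of a torsion object, and in \<open>\<V>\<^sub>1\<close> because \<open>W[1]\<close> is torsion-free and \<open>\<F>[-1] \<subseteq> \<V>\<^sub>1\<close>.\<close>

lemma heart_torsion_memberI:
  assumes "A \<in> \<U>\<^sub>2 \<inter> \<V>\<^sub>1" "\<And>F. F \<in> \<F> \<Longrightarrow> no_maps D A F"
  shows "A \<in> \<T>"
proof (rule torsion_memberI[OF heart_pair assms])
  fix T W assume h: "T \<in> \<T>" "W \<in> Obj D" "Sh D W \<in> \<F>" "is_biproduct D T W A"
  have "no_maps D W Y" if "Y \<in> \<V>\<^sub>2" for Y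
    using no_maps_biproduct_left[OF h(4)] U2_V2[OF _ that] in_heart h by blast
  moreover have "no_maps D X W" if "X \<in> \<U>\<^sub>1" for X
    using shift_U1_F[OF that h(3)] no_maps_Sh[of X W] that h objects by blast
  ultimately show "W \<in> \<U>\<^sub>2 \<inter> \<V>\<^sub>1" using U2_iff V1_iff h by blast
qed

text \<open>The complement \<open>T[1]\<close> is in \<open>\<V>\<^sub>1\<close> as a summand of a torsion-free object, and in \<open>\<U>\<^sub>2\<close>
  because \<open>\<T>[1] \<subseteq> \<U>\<^sub>2\<close>.\<close>

lemma heart_torsion_free_memberI:
  assumes "A \<in> \<U>\<^sub>2 \<inter> \<V>\<^sub>1" "\<And>T. T \<in> \<T> \<Longrightarrow> no_maps D T A"
  shows "A \<in> \<F>"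
proof (rule torsion_free_memberI[OF heart_pair assms])
  fix T F assume h: "T \<in> \<T>" "F \<in> \<F>" "is_biproduct D F A (Sh D T)"
  have "no_maps D X (Sh D T)" if "X \<in> \<U>\<^sub>1" for X
    using no_maps_biproduct_right[OF h(3)] U1_V1[OF that] in_heart h by blast
  moreover have "Sh D T \<in> Obj D" using Sh_Obj in_heart h by blast
  ultimately show "Sh D T \<in> \<U>\<^sub>2 \<inter> \<V>\<^sub>1" using U2_iff V1_iff shift_T_V2[OF h(1)] by blast
qed

text \<open>An object \<open>A\<close> without maps to \<open>\<F> \<union> \<V>\<^sub>2\<close> is approximated by \<open>U \<rightarrow> A \<rightarrow> V\<close> along the lower pair;
  \<open>U[1]\<close> also has no maps to \<open>\<F> \<union> \<V>\<^sub>2\<close>, so neither has \<open>V\<close>, which is thus a torsion object of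
  the heart.\<close>

lemma extended_torsion_eq_left_orth: "star D \<U>\<^sub>1 \<T> = left_orth D (\<F> \<union> \<V>\<^sub>2)"
proof (intro subset_antisym subsetI)
  fix A assume "A \<in> star D \<U>\<^sub>1 \<T>"
  then obtain U T where h: "A \<in> Obj D" "U \<in> \<U>\<^sub>1" "T \<in> \<T>" "tri D U A T"
    unfolding star_def tri_def by blast
  have "no_maps D U Y" "no_maps D T Y" if "Y \<in> \<F> \<union> \<V>\<^sub>2" for Y
    using that U1_V1 U1_V2 U2_V2 T_F in_heart h by blast+
  then show "A \<in> left_orth D (\<F> \<union> \<V>\<^sub>2)"
    using no_maps_from_middle[OF h(4)] h(1) unfolding left_orth_def by blast
next
  fix A assume "A \<in> left_orth D (\<F> \<union> \<V>\<^sub>2)"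
  then have A: "A \<in> Obj D" "\<And>Y. Y \<in> \<F> \<union> \<V>\<^sub>2 \<Longrightarrow> no_maps D A Y" unfolding left_orth_def by auto
  obtain U V where UV: "U \<in> \<U>\<^sub>1" "V \<in> \<V>\<^sub>1" "tri D U A V"
    using torsion_pair_decomposition[OF lower A(1)] .
  have V: "no_maps D V Y" if "Y \<in> \<F> \<union> \<V>\<^sub>2" for Y
    using no_maps_from_cone[OF UV(3) A(2)[OF that]] that shift_U1_F shift_U1_V2 UV(1) by blast
  then have "V \<in> \<U>\<^sub>2" using U2_iff UV objects by blast
  then have "V \<in> \<T>" using heart_torsion_memberI[of V] V UV by blast
  then show "A \<in> star D \<U>\<^sub>1 \<T>" using UV A(1) unfolding star_def tri_def by blast
qed

text \<open>Dually, \<open>A\<close> is approximated along the upper pair, and the vanishing of maps from \<open>\<U>\<^sub>1[1]\<close> and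
  \<open>\<T>[1]\<close> to \<open>\<V>\<^sub>2\<close> puts the torsion part into \<open>\<F>\<close>.\<close>

lemma extended_torsion_free_eq_right_orth: "star D \<F> \<V>\<^sub>2 = right_orth D (\<U>\<^sub>1 \<union> \<T>)"
proof (intro subset_antisym subsetI)
  fix A assume "A \<in> star D \<F> \<V>\<^sub>2"
  then obtain F V where h: "A \<in> Obj D" "F \<in> \<F>" "V \<in> \<V>\<^sub>2" "tri D F A V"
    unfolding star_def tri_def by blast
  have "no_maps D X F" "no_maps D X V" if "X \<in> \<U>\<^sub>1 \<union> \<T>" for X
    using that U1_V1 U1_V2 U2_V2 T_F in_heart h by blast+
  then show "A \<in> right_orth D (\<U>\<^sub>1 \<union> \<T>)"
    using no_maps_to_middle[OF h(4)] h(1) unfolding right_orth_def by blast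
next
  fix A assume "A \<in> right_orth D (\<U>\<^sub>1 \<union> \<T>)"
  then have A: "A \<in> Obj D" "\<And>X. X \<in> \<U>\<^sub>1 \<union> \<T> \<Longrightarrow> no_maps D X A" unfolding right_orth_def by auto
  obtain U V where UV: "U \<in> \<U>\<^sub>2" "V \<in> \<V>\<^sub>2" "tri D U A V"
    using torsion_pair_decomposition[OF upper A(1)] .
  have U: "no_maps D X U" if "X \<in> \<U>\<^sub>1 \<union> \<T>" for X
  proof (rule no_maps_to_cocone[OF UV(3) _ A(2)[OF that]])
    show "X \<in> Obj D" using that in_heart objects by blast
    show "no_maps D (Sh D X) V" using that shift_T_V2 shift_U1_V2 UV(2) by blast
  qed
  then have "U \<in> \<V>\<^sub>1" using V1_iff UV objects by blast
  then have "U \<in> \<F>" using heart_torsion_free_memberI[of U] U UV by blast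
  then show "A \<in> star D \<F> \<V>\<^sub>2" using UV A(1) unfolding star_def tri_def by blast
qed

lemma extension_vanishing:
  assumes "X \<in> star D \<U>\<^sub>1 \<T>" "Y \<in> star D \<F> \<V>\<^sub>2"
  shows "no_maps D X Y"
proof -
  obtain F V where h: "F \<in> \<F>" "V \<in> \<V>\<^sub>2" "tri D F Y V"
    using assms(2) unfolding star_def tri_def by blast
  have "no_maps D X F" "no_maps D X V"
    using assms(1) h unfolding extended_torsion_eq_left_orth left_orth_def by blast+
  then show ?thesis using no_maps_to_middle[OF h(3)] by blast
qed

text \<open>The object \<open>X\<close> is filtered with successive factors in \<open>\<U>\<^sub>1\<close>, \<open>\<T>\<close>, \<open>\<F>\<close> and \<open>\<V>\<^sub>2\<close>; the two
  octahedra group the first two and the last two factors. The middle term \<open>H\<close> lies in the heart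
  since \<open>\<V>\<^sub>2[-1] \<subseteq> \<V>\<^sub>1\<close>.\<close>

lemma extension_decomposition:
  assumes X: "X \<in> Obj D"
  shows "\<exists>P\<in>star D \<U>\<^sub>1 \<T>. \<exists>Q\<in>star D \<F> \<V>\<^sub>2. tri D P X Q"
proof -
  obtain U V where UV: "U \<in> \<U>\<^sub>1" "V \<in> \<V>\<^sub>1" "tri D U X V"
    using torsion_pair_decomposition[OF lower X] .
  obtain H W where HW: "H \<in> \<U>\<^sub>2" "W \<in> \<V>\<^sub>2" "tri D H V W"
    using torsion_pair_decomposition[OF upper] UV objects by blast
  have "no_maps D Z H" if "Z \<in> \<U>\<^sub>1" for Z
    using no_maps_to_cocone[OF HW(3)] that U1_V1 UV shift_U1_V2 HW objects by blast
  then have "H \<in> \<U>\<^sub>2 \<inter> \<V>\<^sub>1" using V1_iff HW objects by blast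
  then obtain T F where TF: "T \<in> \<T>" "F \<in> \<F>" "tri D T H F"
    using torsion_pair_decomposition[OF heart_pair] by blast
  obtain Q where Q: "tri D T V Q" "tri D F Q W" using tri_filtration_quotient[OF TF(3) HW(3)] .
  obtain P where P: "tri D P X Q" "tri D U P T" using tri_filtration_sub[OF UV(3) Q(1)] .
  have "Q \<in> star D \<F> \<V>\<^sub>2" "P \<in> star D \<U>\<^sub>1 \<T>"
    using tri_objects Q P UV HW TF unfolding star_def tri_def by blast+
  then show ?thesis using P by blast
qed

lemma factors_in_extension:
  shows "\<T> \<subseteq> star D \<U>\<^sub>1 \<T>" "\<U>\<^sub>1 \<subseteq> star D \<U>\<^sub>1 \<T>" "\<F> \<subseteq> star D \<F> \<V>\<^sub>2" "\<V>\<^sub>2 \<subseteq> star D \<F> \<V>\<^sub>2"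
  unfolding extended_torsion_eq_left_orth extended_torsion_free_eq_right_orth left_orth_def right_orth_def
  using T_F in_heart objects U1_V1 U1_V2 U2_V2 by blast+

lemma extension_torsion_pair: "torsion_pair D (Obj D) (star D \<U>\<^sub>1 \<T>, star D \<F> \<V>\<^sub>2)"
proof (rule torsion_pairI_orth[OF _ _ extension_decomposition])
  have o: "star D \<U>\<^sub>1 \<T> \<subseteq> Obj D" "star D \<F> \<V>\<^sub>2 \<subseteq> Obj D" unfolding star_def by auto
  have "left_orth D (star D \<F> \<V>\<^sub>2) \<subseteq> star D \<U>\<^sub>1 \<T>"
    unfolding extended_torsion_eq_left_orth using factors_in_extension unfolding left_orth_def by blast
  then show "star D \<U>\<^sub>1 \<T> = left_orth D (star D \<F> \<V>\<^sub>2)"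
    using extension_vanishing o unfolding left_orth_def by blast
  have "right_orth D (star D \<U>\<^sub>1 \<T>) \<subseteq> star D \<F> \<V>\<^sub>2"
    unfolding extended_torsion_free_eq_right_orth using factors_in_extension unfolding right_orth_def by blast
  then show "star D \<F> \<V>\<^sub>2 = right_orth D (star D \<U>\<^sub>1 \<T>)"
    using extension_vanishing o unfolding right_orth_def by blast
qed

text \<open>By orthogonality, an object of \<open>\<U>\<^sub>1 * \<T>\<close> in \<open>\<V>\<^sub>1\<close> belongs to the heart and has no maps
  to \<open>\<F>\<close>, so it is torsion.\<close>

lemma restriction_extension:
  "star D \<U>\<^sub>1 \<T> \<inter> \<V>\<^sub>1 = \<T>" "star D \<F> \<V>\<^sub>2 \<inter> \<U>\<^sub>2 = \<F>"
proof -
  have "A \<in> \<T>" if "A \<in> star D \<U>\<^sub>1 \<T> \<inter> \<V>\<^sub>1" for A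
    by (rule heart_torsion_memberI)
      (use that U2_iff in \<open>auto simp: extended_torsion_eq_left_orth left_orth_def\<close>)
  then show "star D \<U>\<^sub>1 \<T> \<inter> \<V>\<^sub>1 = \<T>" using factors_in_extension in_heart by blast
  have "A \<in> \<F>" if "A \<in> star D \<F> \<V>\<^sub>2 \<inter> \<U>\<^sub>2" for A
    by (rule heart_torsion_free_memberI)
      (use that V1_iff in \<open>auto simp: extended_torsion_free_eq_right_orth right_orth_def\<close>)
  then show "star D \<F> \<V>\<^sub>2 \<inter> \<U>\<^sub>2 = \<F>" using factors_in_extension in_heart by blast
qed

end

text \<open>Only four Hom groups between the factors, and their shifts, have to vanish; the hypothesis is
  about one of the four, and the others vanish for all pairs under consideration. With both pairs
  equal this shows that s-torsion pairs extend to t-structures.\<close>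

lemma extension_prec:
  assumes t: "(\<T>, \<F>) \<in> tors_tilde D (\<U>\<^sub>1, \<V>\<^sub>1) (\<U>\<^sub>2, \<V>\<^sub>2)"
    and t': "(\<T>', \<F>') \<in> tors_tilde D (\<U>\<^sub>1, \<V>\<^sub>1) (\<U>\<^sub>2, \<V>\<^sub>2)"
    and prec: "tors_prec D (\<T>, \<F>) (\<T>', \<F>')"
  shows "tors_prec D (star D \<U>\<^sub>1 \<T>, star D \<F> \<V>\<^sub>2) (star D \<U>\<^sub>1 \<T>', star D \<F>' \<V>\<^sub>2)"
proof -
  have p: "\<And>X Y. X \<in> \<T> \<Longrightarrow> Y \<in> \<F>' \<Longrightarrow> no_maps D X Y \<and> no_maps D (Sh D X) Y"
    using prec tors_prec_iff[OF in_heart(5)[OF t] torsion_pair_closed(4)[OF heart_pair[OF t']]] by blast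
  have "no_maps D X Y \<and> no_maps D (Sh D X) Y"
    if XY: "X \<in> star D \<U>\<^sub>1 \<T>" "Y \<in> star D \<F>' \<V>\<^sub>2" for X Y
  proof -
    obtain U T where h: "X \<in> Obj D" "U \<in> \<U>\<^sub>1" "T \<in> \<T>" "tri D U X T"
      using XY(1) unfolding star_def tri_def by blast
    obtain F V where k: "F \<in> \<F>'" "V \<in> \<V>\<^sub>2" "tri D F Y V"
      using XY(2) unfolding star_def tri_def by blast
    have s: "tri D (Sh D U) (Sh D X) (Sh D T)" using tri_Sh tri_objects[OF h(4)] h(4) by blast
    have "T \<in> \<U>\<^sub>2" "F \<in> \<V>\<^sub>1" using h(3) k(1) in_heart[OF t] in_heart[OF t'] by auto
    then have "no_maps D U F" "no_maps D T V" using U1_V1[OF h(2)] U2_V2[OF _ k(2)] by auto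
    then have X: "no_maps D X F" "no_maps D X V"
      using no_maps_from_middle[OF h(4)] p[OF h(3) k(1)] U1_V2[OF h(2) k(2)] by auto
    have Sh_X: "no_maps D (Sh D X) F" "no_maps D (Sh D X) V"
      using no_maps_from_middle[OF s] p[OF h(3) k(1)] shift_U1_F[OF t' h(2) k(1)]
        shift_U1_V2[OF h(2) k(2)] shift_T_V2[OF t h(3) k(2)] by auto
    show ?thesis using no_maps_to_middle[OF k(3)] X Sh_X by blast
  qed
  then show ?thesis
    using tors_prec_iff torsion_pair_closed(4)[OF extension_torsion_pair[OF t']]
      torsion_pair_closed(5)[OF extension_torsion_pair[OF t]] by blast
qed

lemma extension_in_interval:
  assumes t: "(\<T>, \<F>) \<in> tors_tilde D (\<U>\<^sub>1, \<V>\<^sub>1) (\<U>\<^sub>2, \<V>\<^sub>2)"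
  shows "(star D \<U>\<^sub>1 \<T>, star D \<F> \<V>\<^sub>2) \<in> tors_interval D (\<U>\<^sub>1, \<V>\<^sub>1) (\<U>\<^sub>2, \<V>\<^sub>2)"
proof -
  have "no_maps D X Y \<and> no_maps D (Sh D X) Y" if XY: "X \<in> \<U>\<^sub>1" "Y \<in> star D \<F> \<V>\<^sub>2" for X Y
  proof -
    obtain F V where k: "F \<in> \<F>" "V \<in> \<V>\<^sub>2" "tri D F Y V"
      using XY(2) unfolding star_def tri_def by blast
    have "no_maps D X Y" using factors_in_extension(2)[OF t] extension_vanishing[OF t] XY by blast
    moreover have "no_maps D (Sh D X) Y"
      using no_maps_to_middle[OF k(3)] shift_U1_F[OF t XY(1) k(1)] shift_U1_V2[OF XY(1) k(2)] .
    ultimately show ?thesis by blast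
  qed
  moreover have "no_maps D X Y \<and> no_maps D (Sh D X) Y" if XY: "X \<in> star D \<U>\<^sub>1 \<T>" "Y \<in> \<V>\<^sub>2" for X Y
  proof -
    obtain U T where h: "U \<in> \<U>\<^sub>1" "T \<in> \<T>" "tri D U X T"
      using XY(1) unfolding star_def tri_def by blast
    have s: "tri D (Sh D U) (Sh D X) (Sh D T)" using tri_Sh tri_objects[OF h(3)] h(3) by blast
    have "no_maps D X Y" using factors_in_extension(4)[OF t] extension_vanishing[OF t] XY by blast
    moreover have "no_maps D (Sh D X) Y"
      using no_maps_from_middle[OF s] shift_U1_V2[OF h(1) XY(2)] shift_T_V2[OF t h(2) XY(2)] .
    ultimately show ?thesis by blast
  qed
  ultimately show ?thesis unfolding tors_interval_iff using extension_torsion_pair[OF t] by blast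
qed

text \<open>The restricted pair extends to a torsion pair whose two classes are contained in those of the given
  one; since each class is the orthogonal of the other, both inclusions are equalities.\<close>

lemma extension_restriction:
  assumes t: "(\<U>, \<V>) \<in> tors_interval D (\<U>\<^sub>1, \<V>\<^sub>1) (\<U>\<^sub>2, \<V>\<^sub>2)"
  shows "star D \<U>\<^sub>1 (\<U> \<inter> \<V>\<^sub>1) = \<U>" "star D (\<V> \<inter> \<U>\<^sub>2) \<V>\<^sub>2 = \<V>"
proof -
  have tp: "torsion_pair D (Obj D) (\<U>, \<V>)"
    and l: "\<And>X Y. X \<in> \<U>\<^sub>1 \<Longrightarrow> Y \<in> \<V> \<Longrightarrow> no_maps D X Y"
    and u: "\<And>X Y. X \<in> \<U> \<Longrightarrow> Y \<in> \<V>\<^sub>2 \<Longrightarrow> no_maps D X Y"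
    using t unfolding tors_interval_iff by auto
  note e = extension_torsion_pair[OF restriction_in_heart[OF t]]
  have 1: "star D \<U>\<^sub>1 (\<U> \<inter> \<V>\<^sub>1) \<subseteq> \<U>"
  proof
    fix X assume "X \<in> star D \<U>\<^sub>1 (\<U> \<inter> \<V>\<^sub>1)"
    then obtain U T where h: "X \<in> Obj D" "U \<in> \<U>\<^sub>1" "T \<in> \<U>" "tri D U X T"
      unfolding star_def tri_def by blast
    have "no_maps D X Y" if "Y \<in> \<V>" for Y
      using no_maps_from_middle[OF h(4) l[OF h(2) that] torsion_pair_no_maps[OF tp h(3) that]] .
    then show "X \<in> \<U>" using torsion_pair_orthogonal(1)[OF tp] h(1) unfolding left_orth_def by blast
  qed
  have 2: "star D (\<V> \<inter> \<U>\<^sub>2) \<V>\<^sub>2 \<subseteq> \<V>"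
  proof
    fix Y assume "Y \<in> star D (\<V> \<inter> \<U>\<^sub>2) \<V>\<^sub>2"
    then obtain F V where h: "Y \<in> Obj D" "F \<in> \<V>" "V \<in> \<V>\<^sub>2" "tri D F Y V"
      unfolding star_def tri_def by blast
    have "no_maps D X Y" if "X \<in> \<U>" for X
      using no_maps_to_middle[OF h(4) torsion_pair_no_maps[OF tp that h(2)] u[OF that h(3)]] .
    then show "Y \<in> \<V>" using torsion_pair_orthogonal(2)[OF tp] h(1) unfolding right_orth_def by blast
  qed
  have "left_orth D \<V> \<subseteq> left_orth D (star D (\<V> \<inter> \<U>\<^sub>2) \<V>\<^sub>2)" using 2 unfolding left_orth_def by blast
  then show "star D \<U>\<^sub>1 (\<U> \<inter> \<V>\<^sub>1) = \<U>"
    using 1 torsion_pair_orthogonal(1)[OF e] torsion_pair_orthogonal(1)[OF tp] by blast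
  have "right_orth D \<U> \<subseteq> right_orth D (star D \<U>\<^sub>1 (\<U> \<inter> \<V>\<^sub>1))" using 1 unfolding right_orth_def by blast
  then show "star D (\<V> \<inter> \<U>\<^sub>2) \<V>\<^sub>2 = \<V>"
    using 2 torsion_pair_orthogonal(2)[OF e] torsion_pair_orthogonal(2)[OF tp] by blast
qed

lemma restriction_prec:
  assumes "tors_prec D (\<U>, \<V>) (\<U>', \<V>')"
  shows "tors_prec D (\<U> \<inter> \<V>\<^sub>1, \<V> \<inter> \<U>\<^sub>2) (\<U>' \<inter> \<V>\<^sub>1, \<V>' \<inter> \<U>\<^sub>2)"
  using assms unfolding tors_prec_def Hom_vanishes_def shift_down_def by auto

lemma s_tors_tilde_iff:
  "(\<T>, \<F>) \<in> s_tors_tilde D (\<U>\<^sub>1, \<V>\<^sub>1) (\<U>\<^sub>2, \<V>\<^sub>2) \<longleftrightarrow>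
    (\<T>, \<F>) \<in> tors_tilde D (\<U>\<^sub>1, \<V>\<^sub>1) (\<U>\<^sub>2, \<V>\<^sub>2) \<and> tors_prec D (\<T>, \<F>) (\<T>, \<F>)"
  by (auto simp: s_tors_tilde_def tors_tilde_def s_torsion_pair_def tors_prec_def torsion_pair_def)

text \<open>This and the corresponding fact on s-torsion pairs reduce the bijection on t-structures to the one
  on torsion pairs: for a torsion pair, being related to itself means that the torsion class is
  closed under the shift.\<close>

lemma t_str_interval_iff:
  "(\<L>, \<G>) \<in> t_str_interval D (\<U>\<^sub>1, \<V>\<^sub>1) (\<U>\<^sub>2, \<V>\<^sub>2) \<longleftrightarrow>
    iso_closed_subcat D \<G> \<and> (\<L>, shift_down D \<G>) \<in> tors_interval D (\<U>\<^sub>1, \<V>\<^sub>1) (\<U>\<^sub>2, \<V>\<^sub>2) \<and>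
    tors_prec D (\<L>, shift_down D \<G>) (\<L>, shift_down D \<G>)"
proof (cases "torsion_pair D (Obj D) (\<L>, shift_down D \<G>)")
  case True
  note c = torsion_pair_closed[OF True] and n = torsion_pair_no_maps[OF True]
  have L: "A \<in> \<L> \<longleftrightarrow> A \<in> Obj D \<and> (\<forall>Y\<in>shift_down D \<G>. no_maps D A Y)" for A
    using torsion_pair_orthogonal(1)[OF True] unfolding left_orth_def by blast
  have 1: "tors_prec D (\<L>, shift_down D \<G>) (\<L>, shift_down D \<G>) \<longleftrightarrow> (\<forall>X\<in>\<L>. Sh D X \<in> \<L>)"
    unfolding tors_prec_iff[OF c(5) c(4)] using L Sh_Obj by blast
  have 2: "(\<L>, shift_down D \<G>) \<in> tors_interval D (\<U>\<^sub>1, \<V>\<^sub>1) (\<U>\<^sub>2, \<V>\<^sub>2) \<longleftrightarrow> \<U>\<^sub>1 \<subseteq> \<L> \<and> \<L> \<subseteq> \<U>\<^sub>2"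
    if s: "\<forall>X\<in>\<L>. Sh D X \<in> \<L>"
  proof
    assume "(\<L>, shift_down D \<G>) \<in> tors_interval D (\<U>\<^sub>1, \<V>\<^sub>1) (\<U>\<^sub>2, \<V>\<^sub>2)"
    then show "\<U>\<^sub>1 \<subseteq> \<L> \<and> \<L> \<subseteq> \<U>\<^sub>2" unfolding tors_interval_iff using L U2_iff objects by blast
  next
    assume "\<U>\<^sub>1 \<subseteq> \<L> \<and> \<L> \<subseteq> \<U>\<^sub>2"
    then show "(\<L>, shift_down D \<G>) \<in> tors_interval D (\<U>\<^sub>1, \<V>\<^sub>1) (\<U>\<^sub>2, \<V>\<^sub>2)"
      unfolding tors_interval_iff using True s n U2_V2 by blast
  qed
  show ?thesis unfolding t_str_interval_def using t_structure_iff[of \<L> \<G>] 1 2 True by auto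
next
  case False
  then show ?thesis
    using t_structure_iff[of \<L> \<G>] by (auto simp: t_str_interval_def tors_interval_def)
qed

lemma extension_iso_closed:
  assumes t: "(\<T>, \<F>) \<in> tors_tilde D (\<U>\<^sub>1, \<V>\<^sub>1) (\<U>\<^sub>2, \<V>\<^sub>2)"
  shows "star D (shift_up D \<F>) (shift_up D \<V>\<^sub>2) = shift_up D (star D \<F> \<V>\<^sub>2)"
    and "shift_down D (shift_up D (star D \<F> \<V>\<^sub>2)) = star D \<F> \<V>\<^sub>2"
  using star_shift_up[OF torsion_pair_closed(4)[OF heart_pair[OF t]] iso_closed(4)]
    shift_down_shift_up[OF torsion_pair_closed(4)[OF extension_torsion_pair[OF t]]] by auto


section \<open>The two correspondences\<close>

theorem torsion_pair_bijections:
  "inverse_order_bijections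
     (tors_interval D (\<U>\<^sub>1, \<V>\<^sub>1) (\<U>\<^sub>2, \<V>\<^sub>2)) (tors_prec D)
     (tors_tilde D (\<U>\<^sub>1, \<V>\<^sub>1) (\<U>\<^sub>2, \<V>\<^sub>2)) (tors_prec D)
     (\<lambda>(\<U>, \<V>). (\<U> \<inter> \<V>\<^sub>1, \<V> \<inter> \<U>\<^sub>2))
     (\<lambda>(\<T>, \<F>). (star D \<U>\<^sub>1 \<T>, star D \<F> \<V>\<^sub>2))"
proof (rule inverse_order_bijectionsI, goal_cases)
  case (4 b)
  then show ?case using restriction_extension[of "fst b" "snd b"] by (simp add: case_prod_unfold)
qed (auto simp: restriction_in_heart extension_in_interval extension_restriction
      intro: restriction_prec extension_prec)

theorem t_structure_bijections:
  "inverse_order_bijections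
     (t_str_interval D (\<U>\<^sub>1, \<V>\<^sub>1) (\<U>\<^sub>2, \<V>\<^sub>2)) aisle_le
     (s_tors_tilde D (\<U>\<^sub>1, \<V>\<^sub>1) (\<U>\<^sub>2, \<V>\<^sub>2)) (tors_prec D)
     (\<lambda>(\<L>, \<G>). (\<L> \<inter> \<V>\<^sub>1, shift_down D \<G> \<inter> \<U>\<^sub>2))
     (\<lambda>(\<T>, \<F>). (star D \<U>\<^sub>1 \<T>, star D (shift_up D \<F>) (shift_up D \<V>\<^sub>2)))"
proof (rule inverse_order_bijectionsI, goal_cases)
  case (1 a)
  obtain \<L> \<G> where a: "a = (\<L>, \<G>)" by fastforce
  have t: "(\<L>, shift_down D \<G>) \<in> tors_interval D (\<U>\<^sub>1, \<V>\<^sub>1) (\<U>\<^sub>2, \<V>\<^sub>2)"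
    "tors_prec D (\<L>, shift_down D \<G>) (\<L>, shift_down D \<G>)"
    using 1 unfolding a t_str_interval_iff by auto
  show ?case
    using restriction_in_heart[OF t(1)] restriction_prec[OF t(2)] unfolding a
    by (simp add: s_tors_tilde_iff)
next
  case (2 b)
  obtain \<T> \<F> where b: "b = (\<T>, \<F>)" by fastforce
  have t: "(\<T>, \<F>) \<in> tors_tilde D (\<U>\<^sub>1, \<V>\<^sub>1) (\<U>\<^sub>2, \<V>\<^sub>2)" "tors_prec D (\<T>, \<F>) (\<T>, \<F>)"
    using 2 unfolding b s_tors_tilde_iff by auto
  show ?case
    using extension_in_interval[OF t(1)] extension_prec[OF t(1,1,2)] iso_closed_shift_up unfolding b
    by (simp add: t_str_interval_iff extension_iso_closed[OF t(1)])
next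
  case (3 a)
  obtain \<L> \<G> where a: "a = (\<L>, \<G>)" by fastforce
  have G: "iso_closed_subcat D \<G>" and t: "(\<L>, shift_down D \<G>) \<in> tors_interval D (\<U>\<^sub>1, \<V>\<^sub>1) (\<U>\<^sub>2, \<V>\<^sub>2)"
    using 3 unfolding a t_str_interval_iff by auto
  show ?case
    using extension_iso_closed(1)[OF restriction_in_heart[OF t]] extension_restriction[OF t]
      shift_up_shift_down[OF G] unfolding a by simp
next
  case (4 b)
  obtain \<T> \<F> where b: "b = (\<T>, \<F>)" by fastforce
  have t: "(\<T>, \<F>) \<in> tors_tilde D (\<U>\<^sub>1, \<V>\<^sub>1) (\<U>\<^sub>2, \<V>\<^sub>2)"
    using 4 unfolding b s_tors_tilde_iff by blast
  show ?case using extension_iso_closed[OF t] restriction_extension[OF t] unfolding b by simp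
next
  case (5 a b)
  obtain \<L> \<G> \<L>' \<G>' where ab: "a = (\<L>, \<G>)" "b = (\<L>', \<G>')" by fastforce
  have t: "torsion_pair D (Obj D) (\<L>, shift_down D \<G>)" "torsion_pair D (Obj D) (\<L>', shift_down D \<G>')"
    "tors_prec D (\<L>', shift_down D \<G>') (\<L>', shift_down D \<G>')" "\<L> \<subseteq> \<L>'"
    using 5 unfolding ab t_str_interval_iff tors_interval_iff aisle_le_def by auto
  then have "tors_prec D (\<L>, shift_down D \<G>) (\<L>', shift_down D \<G>')"
    unfolding tors_prec_def Hom_vanishes_def by auto
  then show ?case unfolding ab by (auto intro: restriction_prec)
next
  case (6 a b)
  obtain \<T> \<F> \<T>' \<F>' where ab: "a = (\<T>, \<F>)" "b = (\<T>', \<F>')" by fastforce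
  have t: "(\<T>, \<F>) \<in> tors_tilde D (\<U>\<^sub>1, \<V>\<^sub>1) (\<U>\<^sub>2, \<V>\<^sub>2)" "(\<T>', \<F>') \<in> tors_tilde D (\<U>\<^sub>1, \<V>\<^sub>1) (\<U>\<^sub>2, \<V>\<^sub>2)"
    using 6 unfolding ab s_tors_tilde_iff by auto
  have "tors_prec D (star D \<U>\<^sub>1 \<T>, star D \<F> \<V>\<^sub>2) (star D \<U>\<^sub>1 \<T>', star D \<F>' \<V>\<^sub>2)"
    using extension_prec[OF t] 6 unfolding ab by blast
  then have "star D \<U>\<^sub>1 \<T> \<subseteq> left_orth D (star D \<F>' \<V>\<^sub>2)"
    using torsion_pair_closed(5)[OF extension_torsion_pair[OF t(1)]]
    unfolding left_orth_def tors_prec_def Hom_vanishes_iff_no_maps by blast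
  then show ?case
    using torsion_pair_orthogonal(1)[OF extension_torsion_pair[OF t(2)]] unfolding ab aisle_le_def by simp
qed

end

theorem corollary3p10:
  fixes D :: "('o, 'm) triangulated_data"
    and \<U>\<^sub>1 \<V>\<^sub>1 \<U>\<^sub>2 \<V>\<^sub>2 :: "'o set"
  assumes "triangulated_category D"
    and "torsion_pair D (Obj D) (\<U>\<^sub>1, \<V>\<^sub>1)"
    and "torsion_pair D (Obj D) (\<U>\<^sub>2, \<V>\<^sub>2)"
    and "\<U>\<^sub>1 \<subseteq> \<U>\<^sub>2"
    and "shift_up D \<U>\<^sub>1 \<subseteq> \<U>\<^sub>2"
  shows
    "inverse_order_bijections
       (tors_interval D (\<U>\<^sub>1, \<V>\<^sub>1) (\<U>\<^sub>2, \<V>\<^sub>2)) (tors_prec D)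
       (tors_tilde D (\<U>\<^sub>1, \<V>\<^sub>1) (\<U>\<^sub>2, \<V>\<^sub>2)) (tors_prec D)
       (\<lambda>(\<U>, \<V>). (\<U> \<inter> \<V>\<^sub>1, \<V> \<inter> \<U>\<^sub>2))
       (\<lambda>(\<T>, \<F>). (star D \<U>\<^sub>1 \<T>, star D \<F> \<V>\<^sub>2))
     \<and>
     inverse_order_bijections
       (t_str_interval D (\<U>\<^sub>1, \<V>\<^sub>1) (\<U>\<^sub>2, \<V>\<^sub>2)) aisle_le
       (s_tors_tilde D (\<U>\<^sub>1, \<V>\<^sub>1) (\<U>\<^sub>2, \<V>\<^sub>2)) (tors_prec D)
       (\<lambda>(\<L>, \<G>). (\<L> \<inter> \<V>\<^sub>1, shift_down D \<G> \<inter> \<U>\<^sub>2))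
       (\<lambda>(\<T>, \<F>). (star D \<U>\<^sub>1 \<T>, star D (shift_up D \<F>) (shift_up D \<V>\<^sub>2)))"
proof -
  interpret triangulated_category D by (rule assms(1))
  interpret torsion_interval D \<U>\<^sub>1 \<V>\<^sub>1 \<U>\<^sub>2 \<V>\<^sub>2 by unfold_locales (rule assms)+
  show ?thesis using torsion_pair_bijections t_structure_bijections by blast
qed

end
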